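(* Let $g_B$ satisfy the $C^1$ conic asymptotics and the conic parametrix property near each $p_j\in D$ (see context). For every $\tau>0$ and every $\Phi,\Psi\in C_c^\infty(B)$, the limit as $\rho\downarrow0$ $$K_B^{\mathrm{ren}}(\Phi,\Psi;\tau):=\lim_{\rho\downarrow0}\Big[\int_{B_{\mathrm{reg}}^2}K_B(b,b';\tau)\Phi^{(\rho)}(b)\Psi^{(\rho)}(b')\,d\mu_{g_B}(b)\,d\mu_{g_B}(b')+\sum_{j=1}^N\int_{U_j^2}\chi_j(b)\chi_j(b')K_j^{\mathrm{cone}}(b,b';\tau)\Phi^{<\rho}(b)\Psi^{<\rho}(b')\,d\mu_{g_j^{\mathrm{cone}}}(b)\,d\mu_{g_j^{\mathrm{cone}}}(b')\Big]$$ exists and is finite. Moreover $K_B^{\mathrm{ren}}(\Phi,\Psi;\tau)$ is independent of (i) the wedge charts $(r_j,\theta_j)$, (ii) the choice of cutoffs $\chi_j,\widetilde\chi_j$, and (iii) the cutoff profile $\eta$ used to build $\eta_\rho$. Finally, if $\mathrm{supp}\,\Phi\cup\mathrm{supp}\,\Psi\subset B_{\mathrm{reg}}$, then for $\rho$ sufficiently small $\Phi^{<\rho}=\Psi^{<\rho}=0$, hence $$K_B^{\mathrm{ren}}(\Phi,\Psi;\tau)=\int_{B_{\mathrm{reg}}\times B_{\mathrm{reg}}}K_B(b,b';\tau)\,\Phi(b)\,\Psi(b')\,d\mu_{g_B}(b)\,d\mu_{g_B}(b').$$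
   Context: $B$ is a smooth connected surface, $D=\{p_1,\dots,p_N\}\subset B$ is finite, $B_{\mathrm{reg}}=B\setminus D$, and $g_B$ is a smooth Riemannian metric on $B_{\mathrm{reg}}$. Each $p_j$ has a neighborhood $U_j\subset B$ with $U_j\cap D=\{p_j\}$ and a wedge chart, i.e. polar coordinates $(r_j,\theta_j)\in(0,r_0)\times\mathbb S^1$ on $U_j\setminus\{p_j\}$ with $r_j\downarrow0$ at $p_j$. $C^1$ conic asymptotics: there are $\alpha_j>0$, $\beta\in(0,1]$, $C>0$ such that on $U_j\setminus\{p_j\}$ (writing $r=r_j,\theta=\theta_j$) $g_B=g^{\mathrm{cone}}_j+q_j$, $g_j^{\mathrm{cone}}=dr^2+\alpha_j^2r^2d\theta^2$, $|q_j|_{g_j^{\mathrm{cone}}}\le Cr^\beta$, $|\nabla^{\mathrm{cone}}q_j|_{g_j^{\mathrm{cone}}}\le Cr^{\beta-1}$. In particular $d\mu_{g_B}=(1+O(r^\beta))d\mu_{g_j^{\mathrm{cone}}}$, $d\mu_{g_j^{\mathrm{cone}}}=\alpha_jr\,dr\,d\theta$. $H_B$ is the Friedrichs realization of $-\Delta_{g_B}$ on $L^2(B_{\mathrm{reg}},d\mu_{g_B})$ and $K_B$ its heat kernel. $K_j^{\mathrm{cone}}$ is the heat kernel of the Friedrichs realization of $-\Delta_{g_j^{\mathrm{cone}}}$ on the flat cone $((0,\infty)\times\mathbb S^1,g_j^{\mathrm{cone}})$, viewed on $U_j\setminus\{p_j\}$ through the wedge coordinates. Cutoffs $\chi_j,\widetilde\chi_j\in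 C_c^\infty(U_j)$ satisfy $\chi_j\equiv1$ near $p_j$, $\widetilde\chi_j\equiv1$ on $\mathrm{supp}\,\chi_j$ ($\widetilde\chi_j$ is an auxiliary cutoff used only in constructing the parametrix; it does not appear in the formula for $K_B^{\mathrm{ren}}$). Conic parametrix property: there are $\tau_0\in(0,1]$, $C>0$ and kernels $R_j$ on $(U_j\setminus\{p_j\})^2$ such that for $0<\tau\le\tau_0$ and $b,b'\in U_j\setminus\{p_j\}$, $K_B(b,b';\tau)=\chi_j(b)\chi_j(b')K_j^{\mathrm{cone}}(b,b';\tau)+R_j(b,b';\tau)$ with $|R_j(b,b';\tau)|\le\frac{C}{\tau}(r(b)+r(b'))^\beta\exp\big(-\frac{d_{g_B}(b,b')^2}{C\tau}\big)$. Splitting: fix $\eta\in C^\infty([0,\infty))$ with $\eta\equiv0$ on $[0,1/2]$, $\eta\equiv1$ on $[1,\infty)$. For small $\rho\in(0,r_0)$ let $\eta_\rho=1-\sum_{j}(1-\eta(r_j/\rho))\chi_j\in C^\infty(B)$; $\Phi^{(\rho)}=\eta_\rho\Phi$, $\Phi^{<\rho}=\Phi-\Phi^{(\rho)}$, and similarly for $\Psi$. *)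

theory Defs
  imports "HOL-Analysis.Analysis"
begin

section \<open>Smooth surfaces\<close>

primrec Ck_on :: "nat \<Rightarrow> 'v::real_normed_vector set \<Rightarrow> ('v \<Rightarrow> 'w::real_normed_vector) \<Rightarrow> bool" where
  "Ck_on 0 S f = continuous_on S f"
| "Ck_on (Suc k) S f =
     ((\<forall>x\<in>S. f differentiable (at x)) \<and> (\<forall>v. Ck_on k S (\<lambda>x. frechet_derivative f (at x) v)))"

text \<open>Only used for open \<open>S\<close>.\<close>
definition smooth_on :: "'v::real_normed_vector set \<Rightarrow> ('v \<Rightarrow> 'w::real_normed_vector) \<Rightarrow> bool" where
  "smooth_on S f \<longleftrightarrow> (\<forall>k. Ck_on k S f)"

text \<open>A chart is a pair (domain, coordinate map); values of the map off its domain are irrelevant.\<close>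
type_synonym 'a chart = "'a set \<times> ('a \<Rightarrow> real^2)"

definition chart_inv :: "'a chart \<Rightarrow> real^2 \<Rightarrow> 'a" where
  "chart_inv c = inv_into (fst c) (snd c)"

definition is_chart :: "'a::topological_space set \<Rightarrow> 'a chart \<Rightarrow> bool" where
  "is_chart M c \<longleftrightarrow> openin (top_of_set M) (fst c) \<and> open (snd c ` fst c) \<and>
     homeomorphism (fst c) (snd c ` fst c) (snd c) (chart_inv c)"

definition compatible :: "'a chart \<Rightarrow> 'a chart \<Rightarrow> bool" where
  "compatible c c' \<longleftrightarrow>
     smooth_on (snd c ` (fst c \<inter> fst c')) (snd c' \<circ> chart_inv c) \<and>
     smooth_on (snd c' ` (fst c \<inter> fst c')) (snd c \<circ> chart_inv c')"

definition smooth_atlas :: "'a::topological_space set \<Rightarrow> 'a chart set \<Rightarrow> bool" where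
  "smooth_atlas M A \<longleftrightarrow> (\<forall>c\<in>A. is_chart M c) \<and> (\<Union>c\<in>A. fst c) = M \<and>
     (\<forall>c\<in>A. \<forall>c'\<in>A. compatible c c')"

text \<open>The smooth structure is given by its maximal atlas. Hausdorffness and second countability of
  \<open>B\<close> come from the type class.\<close>
definition smooth_surface :: "'a::{t2_space, second_countable_topology} set \<Rightarrow> 'a chart set \<Rightarrow> bool" where
  "smooth_surface B A \<longleftrightarrow> smooth_atlas B A \<and>
     (\<forall>c. is_chart B c \<and> (\<forall>c'\<in>A. compatible c c') \<longrightarrow> c \<in> A)"

definition atlas_on :: "'a chart set \<Rightarrow> 'a set \<Rightarrow> 'a chart set" where
  "atlas_on A W = {c \<in> A. fst c \<subseteq> W}"

definition smooth_fun :: "'a chart set \<Rightarrow> ('a \<Rightarrow> real) \<Rightarrow> bool" where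
  "smooth_fun A f \<longleftrightarrow> (\<forall>c\<in>A. smooth_on (snd c ` fst c) (f \<circ> chart_inv c))"

definition support_in :: "'a::topological_space set \<Rightarrow> ('a \<Rightarrow> real) \<Rightarrow> 'a set" where
  "support_in M f = M \<inter> closure {x \<in> M. f x \<noteq> 0}"

text \<open>The space \<open>C\<^sub>c\<^sup>\<infinity>(M)\<close>.\<close>
definition test_function :: "'a::topological_space set \<Rightarrow> 'a chart set \<Rightarrow> ('a \<Rightarrow> real) \<Rightarrow> bool" where
  "test_function M A f \<longleftrightarrow> smooth_fun A f \<and> compact (support_in M f)"


section \<open>Riemannian metrics\<close>

definition partial :: "2 \<Rightarrow> (real^2 \<Rightarrow> real) \<Rightarrow> real^2 \<Rightarrow> real" where
  "partial i f x = frechet_derivative f (at x) (axis i 1)"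

text \<open>A metric is given by its component matrix \<open>g c p\<close> at the point \<open>p\<close> in the chart \<open>c\<close>.\<close>
type_synonym 'a metric = "'a chart \<Rightarrow> 'a \<Rightarrow> real^2^2"

definition jacobian :: "'a chart \<Rightarrow> 'a chart \<Rightarrow> 'a \<Rightarrow> real^2^2" where
  "jacobian c c' p = matrix (frechet_derivative (snd c' \<circ> chart_inv c) (at (snd c p)))"

definition riemannian_metric :: "'a chart set \<Rightarrow> 'a metric \<Rightarrow> bool" where
  "riemannian_metric A g \<longleftrightarrow>
     (\<forall>c\<in>A. smooth_on (snd c ` fst c) (g c \<circ> chart_inv c) \<and>
        (\<forall>p\<in>fst c. transpose (g c p) = g c p \<and> (\<forall>v. v \<noteq> 0 \<longrightarrow> 0 < v \<bullet> (g c p *v v)))) \<and>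
     (\<forall>c\<in>A. \<forall>c'\<in>A. \<forall>p\<in>fst c \<inter> fst c'.
        g c p = transpose (jacobian c c' p) ** g c' p ** jacobian c c' p)"

text \<open>The Riemannian measure: a Borel measure on \<open>M\<close> that is \<open>sqrt (det g) dx\<close> in every chart.\<close>
definition riemannian_measure ::
  "'a::topological_space set \<Rightarrow> 'a chart set \<Rightarrow> 'a metric \<Rightarrow> 'a measure \<Rightarrow> bool" where
  "riemannian_measure M A g \<mu> \<longleftrightarrow> sets \<mu> = sets (restrict_space borel M) \<and>
     (\<forall>c\<in>A. \<forall>S\<in>sets \<mu>. S \<subseteq> fst c \<longrightarrow>
        emeasure \<mu> S = (\<integral>\<^sup>+x\<in>snd c ` S. ennreal (sqrt (det (g c (chart_inv c x)))) \<partial>lborel))"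

text \<open>The quantities below that use \<open>chart_at\<close> do not depend on the chart that is selected.\<close>
definition chart_at :: "'a chart set \<Rightarrow> 'a \<Rightarrow> 'a chart" where
  "chart_at A p = (SOME c. c \<in> A \<and> p \<in> fst c)"

definition laplacian :: "'a chart set \<Rightarrow> 'a metric \<Rightarrow> ('a \<Rightarrow> real) \<Rightarrow> 'a \<Rightarrow> real" where
  "laplacian A g u p =
     (let c = chart_at A p; G = (\<lambda>x. g c (chart_inv c x)); w = (\<lambda>x. sqrt (det (G x))) in
        (\<Sum>i\<in>UNIV. \<Sum>j\<in>UNIV.
           partial i (\<lambda>x. w x * matrix_inv (G x) $ i $ j * partial j (u \<circ> chart_inv c) x) (snd c p))
        / w (snd c p))"

definition piecewise_C1_curve :: "'a::topological_space set \<Rightarrow> 'a chart set \<Rightarrow> (real \<Rightarrow> 'a) \<Rightarrow> bool" where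
  "piecewise_C1_curve M A \<gamma> \<longleftrightarrow> continuous_on {0..1} \<gamma> \<and> \<gamma> ` {0..1} \<subseteq> M \<and>
     (\<forall>c\<in>A. \<forall>a b. 0 \<le> a \<and> a < b \<and> b \<le> 1 \<and> \<gamma> ` {a..b} \<subseteq> fst c \<longrightarrow>
        (snd c \<circ> \<gamma>) piecewise_C1_differentiable_on {a..b})"

definition curve_length :: "'a chart set \<Rightarrow> 'a metric \<Rightarrow> (real \<Rightarrow> 'a) \<Rightarrow> ennreal" where
  "curve_length A g \<gamma> =
     (\<integral>\<^sup>+t\<in>{0..1}. (let c = chart_at A (\<gamma> t); v = vector_derivative (snd c \<circ> \<gamma>) (at t)
                     in ennreal (sqrt (v \<bullet> (g c (\<gamma> t) *v v)))) \<partial>lborel)"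

definition riemannian_dist ::
  "'a::topological_space set \<Rightarrow> 'a chart set \<Rightarrow> 'a metric \<Rightarrow> 'a \<Rightarrow> 'a \<Rightarrow> real" where
  "riemannian_dist M A g p q =
     enn2real (Inf {curve_length A g \<gamma> | \<gamma>. piecewise_C1_curve M A \<gamma> \<and> \<gamma> 0 = p \<and> \<gamma> 1 = q})"


section \<open>Friedrichs realization and heat kernel\<close>

text \<open>Real \<open>L\<^sup>2\<close>, with functions as representatives of their classes.\<close>
definition L2 :: "'a measure \<Rightarrow> ('a \<Rightarrow> real) set" where
  "L2 \<mu> = {f \<in> borel_measurable \<mu>. integrable \<mu> (\<lambda>x. (f x)\<^sup>2)}"

definition L2_inner :: "'a measure \<Rightarrow> ('a \<Rightarrow> real) \<Rightarrow> ('a \<Rightarrow> real) \<Rightarrow> real" where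
  "L2_inner \<mu> f h = (\<integral>x. f x * h x \<partial>\<mu>)"

definition L2_norm :: "'a measure \<Rightarrow> ('a \<Rightarrow> real) \<Rightarrow> real" where
  "L2_norm \<mu> f = sqrt (\<integral>x. (f x)\<^sup>2 \<partial>\<mu>)"

text \<open>The graph of the Friedrichs extension of a nonnegative symmetric operator \<open>S\<close> with domain
  \<open>D0\<close>: \<open>u\<close> lies in the form domain, the closure of \<open>D0\<close> under the form
  \<open>q(\<phi>,\<psi>) = \<langle>S \<phi>, \<psi>\<rangle>\<close>, and the closed form satisfies \<open>q(u,v) = \<langle>f, v\<rangle>\<close> for all \<open>v\<close> in the core \<open>D0\<close>.\<close>
definition friedrichs ::
  "'a measure \<Rightarrow> ('a \<Rightarrow> real) set \<Rightarrow> (('a \<Rightarrow> real) \<Rightarrow> 'a \<Rightarrow> real) \<Rightarrow> (('a \<Rightarrow> real) \<times> ('a \<Rightarrow> real)) set" where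
  "friedrichs \<mu> D0 S =
     {(u, f). u \<in> L2 \<mu> \<and> f \<in> L2 \<mu> \<and>
        (\<exists>\<phi> :: nat \<Rightarrow> 'a \<Rightarrow> real. (\<forall>n. \<phi> n \<in> D0) \<and>
           (\<lambda>n. L2_norm \<mu> (\<lambda>x. \<phi> n x - u x)) \<longlonglongrightarrow> 0 \<and>
           (\<forall>\<epsilon>>0. \<exists>N. \<forall>m\<ge>N. \<forall>n\<ge>N.
              L2_inner \<mu> (S (\<lambda>x. \<phi> m x - \<phi> n x)) (\<lambda>x. \<phi> m x - \<phi> n x) < \<epsilon>) \<and>
           (\<forall>v\<in>D0. (\<lambda>n. L2_inner \<mu> (S (\<phi> n)) v) \<longlonglongrightarrow> L2_inner \<mu> f v))}"

text \<open>A strongly continuous semigroup of bounded operators on \<open>L\<^sup>2\<close> (with \<open>T 0\<close> understood as the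
  identity).\<close>
definition C0_semigroup :: "'a measure \<Rightarrow> (real \<Rightarrow> ('a \<Rightarrow> real) \<Rightarrow> 'a \<Rightarrow> real) \<Rightarrow> bool" where
  "C0_semigroup \<mu> T \<longleftrightarrow>
     (\<forall>t>0. \<exists>C. \<forall>f\<in>L2 \<mu>. T t f \<in> L2 \<mu> \<and> L2_norm \<mu> (T t f) \<le> C * L2_norm \<mu> f) \<and>
     (\<forall>t>0. \<forall>f\<in>L2 \<mu>. \<forall>h\<in>L2 \<mu>. \<forall>a b.
        AE x in \<mu>. T t (\<lambda>y. a * f y + b * h y) x = a * T t f x + b * T t h x) \<and>
     (\<forall>s>0. \<forall>t>0. \<forall>f\<in>L2 \<mu>. AE x in \<mu>. T (s + t) f x = T s (T t f) x) \<and>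
     (\<forall>f\<in>L2 \<mu>. ((\<lambda>t. L2_norm \<mu> (\<lambda>x. T t f x - f x)) \<longlongrightarrow> 0) (at_right 0))"

text \<open>\<open>-H\<close> (given by the graph of \<open>H\<close>) is the infinitesimal generator, i.e. \<open>T t = exp (-t H)\<close>.\<close>
definition generated_by_minus ::
  "'a measure \<Rightarrow> (real \<Rightarrow> ('a \<Rightarrow> real) \<Rightarrow> 'a \<Rightarrow> real) \<Rightarrow> (('a \<Rightarrow> real) \<times> ('a \<Rightarrow> real)) set \<Rightarrow> bool" where
  "generated_by_minus \<mu> T H \<longleftrightarrow>
     (\<forall>u\<in>L2 \<mu>. \<forall>f\<in>L2 \<mu>. (u, f) \<in> H \<longleftrightarrow>
        ((\<lambda>t. L2_norm \<mu> (\<lambda>x. (T t u x - u x) / t + f x)) \<longlongrightarrow> 0) (at_right 0))"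

definition kernel_op ::
  "'a measure \<Rightarrow> ('a \<Rightarrow> 'a \<Rightarrow> real \<Rightarrow> real) \<Rightarrow> real \<Rightarrow> ('a \<Rightarrow> real) \<Rightarrow> 'a \<Rightarrow> real" where
  "kernel_op \<mu> K t f b = (\<integral>b'. K b b' t * f b' \<partial>\<mu>)"

text \<open>The heat kernel of the Friedrichs realization \<open>H\<close> of \<open>-\<Delta>\<^sub>g\<close> (from \<open>C\<^sub>c\<^sup>\<infinity>(M)\<close>): the continuous
  nonnegative integral kernel of \<open>exp (-t H)\<close>. Continuity makes it unique on \<open>M \<times> M\<close>;
  nonnegativity is automatic (Beurling-Deny) and is recorded as part of the usual notion.\<close>
definition heat_kernel ::
  "'a::topological_space set \<Rightarrow> 'a chart set \<Rightarrow> 'a metric \<Rightarrow> 'a measure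
     \<Rightarrow> ('a \<Rightarrow> 'a \<Rightarrow> real \<Rightarrow> real) \<Rightarrow> bool" where
  "heat_kernel M A g \<mu> K \<longleftrightarrow>
     (\<forall>t>0. continuous_on (M \<times> M) (\<lambda>(b, b'). K b b' t) \<and> (\<forall>b\<in>M. \<forall>b'\<in>M. 0 \<le> K b b' t)) \<and>
     (\<forall>t>0. \<forall>f\<in>L2 \<mu>. AE b in \<mu>. integrable \<mu> (\<lambda>b'. K b b' t * f b')) \<and>
     C0_semigroup \<mu> (kernel_op \<mu> K) \<and>
     generated_by_minus \<mu> (kernel_op \<mu> K)
       (friedrichs \<mu> {\<phi>. test_function M A \<phi>} (\<lambda>u x. - laplacian A g u x))"


section \<open>The flat cone\<close>

type_synonym cone_point = "real \<times> complex"

definition cone_space :: "cone_point set" where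
  "cone_space = {0<..} \<times> sphere 0 1"

text \<open>The coordinates \<open>(r, \<theta>)\<close> with the branch of the angle in \<open>(t, t + 2 \<pi>)\<close>.\<close>
definition angular_chart :: "real \<Rightarrow> cone_point chart" where
  "angular_chart t =
     ({(r, cis s) | r s. 0 < r \<and> t < s \<and> s < t + 2 * pi},
      \<lambda>(r, z). vector [r, THE s. t < s \<and> s < t + 2 * pi \<and> cis s = z])"

definition cone_atlas :: "cone_point chart set" where
  "cone_atlas = range angular_chart"

text \<open>\<open>dr\<^sup>2 + \<alpha>\<^sup>2 r\<^sup>2 d\<theta>\<^sup>2\<close>\<close>
definition cone_matrix :: "real \<Rightarrow> real \<Rightarrow> real^2^2" where
  "cone_matrix \<alpha> r = vector [vector [1, 0], vector [0, \<alpha>\<^sup>2 * r\<^sup>2]]"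

definition cone_metric :: "real \<Rightarrow> cone_point metric" where
  "cone_metric \<alpha> c x = cone_matrix \<alpha> (fst x)"

text \<open>\<open>\<alpha> r dr d\<theta>\<close>\<close>
definition cone_measure :: "real \<Rightarrow> cone_point measure" where
  "cone_measure \<alpha> =
     distr (density (restrict_space lborel ({0<..} \<times> {-pi<..pi})) (\<lambda>(r, s). ennreal (\<alpha> * r)))
       (restrict_space borel cone_space) (\<lambda>(r, s). (r, cis s))"


section \<open>Wedge charts and conic asymptotics\<close>

text \<open>All fields but \<open>rad0\<close> (which is \<open>r\<^sub>0\<close>) are indexed by the points of \<open>D\<close>: the neighborhoods \<open>U\<^sub>j\<close>,
  the coordinates \<open>r\<^sub>j\<close> and \<open>\<theta>\<^sub>j\<close> (a unit complex number), and the cone parameters \<open>\<alpha>\<^sub>j\<close>.\<close>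
record 'a wedge_charts =
  nbhd :: "'a \<Rightarrow> 'a set"
  rad0 :: real
  rad :: "'a \<Rightarrow> 'a \<Rightarrow> real"
  ang :: "'a \<Rightarrow> 'a \<Rightarrow> complex"
  cone_par :: "'a \<Rightarrow> real"

definition pnbhd :: "'a wedge_charts \<Rightarrow> 'a \<Rightarrow> 'a set" where
  "pnbhd W p = nbhd W p - {p}"

definition wedge_map :: "'a wedge_charts \<Rightarrow> 'a \<Rightarrow> 'a \<Rightarrow> cone_point" where
  "wedge_map W p b = (rad W p b, ang W p b)"

definition wedge_coord :: "'a wedge_charts \<Rightarrow> 'a \<Rightarrow> real \<Rightarrow> 'a chart" where
  "wedge_coord W p t =
     ({b \<in> pnbhd W p. wedge_map W p b \<in> fst (angular_chart t)}, snd (angular_chart t) \<circ> wedge_map W p)"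

text \<open>The wedge map is a diffeomorphism of \<open>U\<^sub>j - {p\<^sub>j}\<close> onto \<open>(0,r\<^sub>0) \<times> S\<^sup>1\<close>: it is bijective, and its
  composition with every angular chart belongs to the maximal atlas. At \<open>p\<^sub>j\<close> itself \<open>r\<^sub>j\<close> takes its
  limit value \<open>0\<close>.\<close>
definition wedge_system :: "'a::topological_space set \<Rightarrow> 'a chart set \<Rightarrow> 'a set \<Rightarrow> 'a wedge_charts \<Rightarrow> bool" where
  "wedge_system B A D W \<longleftrightarrow> 0 < rad0 W \<and>
     (\<forall>p\<in>D. openin (top_of_set B) (nbhd W p) \<and> nbhd W p \<inter> D = {p} \<and>
        bij_betw (wedge_map W p) (pnbhd W p) ({0<..<rad0 W} \<times> sphere 0 1) \<and>
        (\<forall>t. wedge_coord W p t \<in> A) \<and>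
        rad W p p = 0 \<and> (rad W p \<longlongrightarrow> 0) (at p within pnbhd W p))"

text \<open>Norms of covariant tensors of rank 2 and 3 with respect to the metric \<open>G\<close> at a point, and the
  Levi-Civita derivative \<open>(\<nabla>T)\<^sub>k\<^sub>i\<^sub>j\<close> in coordinates.\<close>
definition tensor2_norm :: "real^2^2 \<Rightarrow> (2 \<Rightarrow> 2 \<Rightarrow> real) \<Rightarrow> real" where
  "tensor2_norm G T = sqrt (\<Sum>i\<in>UNIV. \<Sum>j\<in>UNIV. \<Sum>i'\<in>UNIV. \<Sum>j'\<in>UNIV.
     matrix_inv G $ i $ i' * matrix_inv G $ j $ j' * T i j * T i' j')"

definition tensor3_norm :: "real^2^2 \<Rightarrow> (2 \<Rightarrow> 2 \<Rightarrow> 2 \<Rightarrow> real) \<Rightarrow> real" where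
  "tensor3_norm G T = sqrt (\<Sum>k\<in>UNIV. \<Sum>i\<in>UNIV. \<Sum>j\<in>UNIV. \<Sum>k'\<in>UNIV. \<Sum>i'\<in>UNIV. \<Sum>j'\<in>UNIV.
     matrix_inv G $ k $ k' * matrix_inv G $ i $ i' * matrix_inv G $ j $ j' * T k i j * T k' i' j')"

definition christoffel :: "(real^2 \<Rightarrow> real^2^2) \<Rightarrow> real^2 \<Rightarrow> 2 \<Rightarrow> 2 \<Rightarrow> 2 \<Rightarrow> real" where
  "christoffel G x l i j = (\<Sum>m\<in>UNIV. matrix_inv (G x) $ l $ m *
     (partial i (\<lambda>y. G y $ j $ m) x + partial j (\<lambda>y. G y $ i $ m) x - partial m (\<lambda>y. G y $ i $ j) x)) / 2"

definition covariant_derivative ::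
  "(real^2 \<Rightarrow> real^2^2) \<Rightarrow> (real^2 \<Rightarrow> real^2^2) \<Rightarrow> real^2 \<Rightarrow> 2 \<Rightarrow> 2 \<Rightarrow> 2 \<Rightarrow> real" where
  "covariant_derivative G T x k i j = partial k (\<lambda>y. T y $ i $ j) x
     - (\<Sum>l\<in>UNIV. christoffel G x l k i * T x $ l $ j)
     - (\<Sum>l\<in>UNIV. christoffel G x l k j * T x $ i $ l)"

definition conic_asymptotics :: "'a set \<Rightarrow> 'a metric \<Rightarrow> 'a wedge_charts \<Rightarrow> real \<Rightarrow> bool" where
  "conic_asymptotics D g W \<beta> \<longleftrightarrow> 0 < \<beta> \<and> \<beta> \<le> 1 \<and> (\<forall>p\<in>D. 0 < cone_par W p) \<and>
     (\<exists>C>0. \<forall>p\<in>D. \<forall>t. \<forall>b\<in>fst (wedge_coord W p t).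
        let c = wedge_coord W p t; G0 = (\<lambda>x. cone_matrix (cone_par W p) (x $ 1));
            q = (\<lambda>x. g c (chart_inv c x) - G0 x); x = snd c b
        in tensor2_norm (G0 x) (\<lambda>i j. q x $ i $ j) \<le> C * rad W p b powr \<beta> \<and>
           tensor3_norm (G0 x) (covariant_derivative G0 q x) \<le> C * rad W p b powr (\<beta> - 1))"

text \<open>\<open>\<kappa> p\<close> stands for \<open>\<chi>\<^sub>j\<close> (the letter chi is a binder here) and \<open>\<kappa>t p\<close> for the auxiliary cutoff;
  both are functions on \<open>B\<close>, extended by zero outside \<open>U\<^sub>j\<close>.\<close>
definition cutoffs :: "'a::topological_space set \<Rightarrow> 'a chart set \<Rightarrow> 'a set \<Rightarrow> 'a wedge_charts
    \<Rightarrow> ('a \<Rightarrow> 'a \<Rightarrow> real) \<Rightarrow> ('a \<Rightarrow> 'a \<Rightarrow> real) \<Rightarrow> bool" where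
  "cutoffs B A D W \<kappa> \<kappa>t \<longleftrightarrow>
     (\<forall>p\<in>D. test_function B A (\<kappa> p) \<and> support_in B (\<kappa> p) \<subseteq> nbhd W p \<and>
            test_function B A (\<kappa>t p) \<and> support_in B (\<kappa>t p) \<subseteq> nbhd W p \<and>
            (\<exists>V. openin (top_of_set B) V \<and> p \<in> V \<and> (\<forall>b\<in>V. \<kappa> p b = 1)) \<and>
            (\<forall>b\<in>support_in B (\<kappa> p). \<kappa>t p b = 1))"

text \<open>\<open>Kc \<alpha>\<close> is the heat kernel of the cone with parameter \<open>\<alpha>\<close>.\<close>
definition wedge_cone_kernel :: "(real \<Rightarrow> cone_point \<Rightarrow> cone_point \<Rightarrow> real \<Rightarrow> real) \<Rightarrow> 'a wedge_charts
    \<Rightarrow> 'a \<Rightarrow> 'a \<Rightarrow> 'a \<Rightarrow> real \<Rightarrow> real" where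
  "wedge_cone_kernel Kc W p b b' \<tau> = Kc (cone_par W p) (wedge_map W p b) (wedge_map W p b') \<tau>"

definition conic_parametrix ::
  "'a::topological_space set \<Rightarrow> 'a chart set \<Rightarrow> 'a set \<Rightarrow> 'a metric \<Rightarrow> ('a \<Rightarrow> 'a \<Rightarrow> real \<Rightarrow> real)
    \<Rightarrow> (real \<Rightarrow> cone_point \<Rightarrow> cone_point \<Rightarrow> real \<Rightarrow> real)
    \<Rightarrow> 'a wedge_charts \<Rightarrow> real \<Rightarrow> ('a \<Rightarrow> 'a \<Rightarrow> real) \<Rightarrow> bool" where
  "conic_parametrix B A D g K Kc W \<beta> \<kappa> \<longleftrightarrow>
     (\<exists>\<tau>0 C R. 0 < \<tau>0 \<and> \<tau>0 \<le> 1 \<and> 0 < C \<and>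
        (\<forall>p\<in>D. \<forall>\<tau>. 0 < \<tau> \<and> \<tau> \<le> \<tau>0 \<longrightarrow> (\<forall>b\<in>pnbhd W p. \<forall>b'\<in>pnbhd W p.
           K b b' \<tau> = \<kappa> p b * \<kappa> p b' * wedge_cone_kernel Kc W p b b' \<tau> + R p b b' \<tau> \<and>
           \<bar>R p b b' \<tau>\<bar> \<le> C / \<tau> * (rad W p b + rad W p b') powr \<beta> *
              exp (- (riemannian_dist (B - D) (atlas_on A (B - D)) g b b')\<^sup>2 / (C * \<tau>)))))"


section \<open>The renormalized heat pairing\<close>

text \<open>Smoothness on \<open>(0,\<infinity>)\<close> is smoothness on \<open>[0,\<infinity>)\<close> here, as \<open>\<eta>\<close> vanishes on \<open>[0,1/2]\<close>.\<close>
definition cutoff_profile :: "(real \<Rightarrow> real) \<Rightarrow> bool" where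
  "cutoff_profile \<eta> \<longleftrightarrow> smooth_on {0<..} \<eta> \<and> (\<forall>s\<in>{0..1/2}. \<eta> s = 0) \<and> (\<forall>s\<ge>1. \<eta> s = 1)"

definition eta_cut :: "'a set \<Rightarrow> 'a wedge_charts \<Rightarrow> ('a \<Rightarrow> 'a \<Rightarrow> real) \<Rightarrow> (real \<Rightarrow> real) \<Rightarrow> real \<Rightarrow> 'a \<Rightarrow> real" where
  "eta_cut D W \<kappa> \<eta> \<rho> b = 1 - (\<Sum>p\<in>D. (1 - \<eta> (rad W p b / \<rho>)) * \<kappa> p b)"

text \<open>\<open>outer_part\<close> is \<open>\<Phi>\<^bsup>(\<rho>)\<^esup>\<close>, \<open>inner_part\<close> is \<open>\<Phi> - \<Phi>\<^bsup>(\<rho>)\<^esup>\<close>.\<close>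
definition outer_part where
  "outer_part D W \<kappa> \<eta> \<rho> \<Phi> b = eta_cut D W \<kappa> \<eta> \<rho> b * \<Phi> b"

definition inner_part where
  "inner_part D W \<kappa> \<eta> \<rho> \<Phi> b = \<Phi> b - outer_part D W \<kappa> \<eta> \<rho> \<Phi> b"

text \<open>The Riemannian measure of the cone metric on \<open>U\<^sub>j - {p\<^sub>j}\<close>, transported through the wedge coordinates.\<close>
definition wedge_measure :: "'a::topological_space wedge_charts \<Rightarrow> 'a \<Rightarrow> 'a measure" where
  "wedge_measure W p =
     distr (restrict_space (cone_measure (cone_par W p)) ({0<..<rad0 W} \<times> sphere 0 1))
       (restrict_space borel (pnbhd W p)) (inv_into (pnbhd W p) (wedge_map W p))"

definition bulk_integrand where
  "bulk_integrand D K W \<kappa> \<eta> \<Phi> \<Psi> \<tau> \<rho> =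
     (\<lambda>(b, b'). K b b' \<tau> * outer_part D W \<kappa> \<eta> \<rho> \<Phi> b * outer_part D W \<kappa> \<eta> \<rho> \<Psi> b')"

definition cone_integrand where
  "cone_integrand D Kc W \<kappa> \<eta> \<Phi> \<Psi> \<tau> \<rho> p =
     (\<lambda>(b, b'). \<kappa> p b * \<kappa> p b' * wedge_cone_kernel Kc W p b b' \<tau> *
        inner_part D W \<kappa> \<eta> \<rho> \<Phi> b * inner_part D W \<kappa> \<eta> \<rho> \<Psi> b')"

definition heat_pairing ::
  "'a::topological_space set \<Rightarrow> 'a measure \<Rightarrow> ('a \<Rightarrow> 'a \<Rightarrow> real \<Rightarrow> real)
    \<Rightarrow> (real \<Rightarrow> cone_point \<Rightarrow> cone_point \<Rightarrow> real \<Rightarrow> real)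
    \<Rightarrow> 'a wedge_charts \<Rightarrow> ('a \<Rightarrow> 'a \<Rightarrow> real) \<Rightarrow> (real \<Rightarrow> real)
    \<Rightarrow> ('a \<Rightarrow> real) \<Rightarrow> ('a \<Rightarrow> real) \<Rightarrow> real \<Rightarrow> real \<Rightarrow> real" where
  "heat_pairing D \<mu> K Kc W \<kappa> \<eta> \<Phi> \<Psi> \<tau> \<rho> =
     (\<integral>z. bulk_integrand D K W \<kappa> \<eta> \<Phi> \<Psi> \<tau> \<rho> z \<partial>(\<mu> \<Otimes>\<^sub>M \<mu>)) +
     (\<Sum>p\<in>D. \<integral>z. cone_integrand D Kc W \<kappa> \<eta> \<Phi> \<Psi> \<tau> \<rho> p z \<partial>(wedge_measure W p \<Otimes>\<^sub>M wedge_measure W p))"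

text \<open>All integrals in the pairing converge absolutely.\<close>
definition heat_pairing_defined where
  "heat_pairing_defined D \<mu> K Kc W \<kappa> \<eta> \<Phi> \<Psi> \<tau> \<rho> \<longleftrightarrow>
     integrable (\<mu> \<Otimes>\<^sub>M \<mu>) (bulk_integrand D K W \<kappa> \<eta> \<Phi> \<Psi> \<tau> \<rho>) \<and>
     (\<forall>p\<in>D. integrable (wedge_measure W p \<Otimes>\<^sub>M wedge_measure W p)
               (cone_integrand D Kc W \<kappa> \<eta> \<Phi> \<Psi> \<tau> \<rho> p))"

definition K_ren where
  "K_ren D \<mu> K Kc W \<kappa> \<eta> \<Phi> \<Psi> \<tau> = Lim (at_right 0) (heat_pairing D \<mu> K Kc W \<kappa> \<eta> \<Phi> \<Psi> \<tau>)"

text \<open>The limit defining \<open>K_ren\<close> exists and is finite.\<close>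
definition K_ren_exists where
  "K_ren_exists D \<mu> K Kc W \<kappa> \<eta> \<Phi> \<Psi> \<tau> \<longleftrightarrow>
     (\<forall>\<^sub>F \<rho> in at_right 0. heat_pairing_defined D \<mu> K Kc W \<kappa> \<eta> \<Phi> \<Psi> \<tau> \<rho>) \<and>
     (\<exists>L::real. (heat_pairing D \<mu> K Kc W \<kappa> \<eta> \<Phi> \<Psi> \<tau> \<longlongrightarrow> L) (at_right 0))"

end

theory Submission
  imports Defs
begin

text \<open>The renormalized pairing is always the plain integral \<open>\<integral>\<integral> K \<Phi> \<Psi> d\<mu> d\<mu>\<close>, which mentions none of the
  auxiliary choices. The \<open>C\<^sup>0\<close> part of the conic asymptotics makes \<open>sqrt (det g)\<close> bounded in wedge
  coordinates, so compact subsets of \<open>B\<close> have finite measure even if they contain points of \<open>D\<close>. For a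
  set \<open>S\<close> of finite measure, nonnegativity of the heat kernel and boundedness of the heat operator on \<open>L\<^sup>2\<close>
  give \<open>\<integral>\<integral>\<^bsub>S \<times> S\<^esub> K = \<langle>1\<^sub>S, T 1\<^sub>S\<rangle> < \<infinity>\<close>; the same holds on a truncated cone. Dominated convergence then sends the
  bulk term to the plain integral and each cone term to \<open>0\<close>.\<close>

section \<open>Charts of a smooth surface\<close>

text \<open>By definition a heat kernel is continuous on the regular part only, which bounds neither
  \<open>K\<close> nor the cone kernel near the tips, while supports of test functions may contain
  tips. Integrability therefore rests on an operator bound, available at every time
  \<open>\<tau> > 0\<close>. Pointwise convergence, by contrast, is immediate: off \<open>D\<close>
  the cutoff \<open>eta_cut\<close> equals 1 once \<open>\<rho>\<close> is below the finitely many
  radii of the point, and the tips do not belong to the measure spaces. The rest of the effort goes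
  into measure theory. \<open>\<mu>\<close> is specified only by its values inside charts, so its
  sigma-finiteness and its finiteness near tips must be extracted from local information. The radius
  and the angle carry information only on punctured neighborhoods, and their regularity is known
  only after composition with a branch of the angle. Continuity of the wedge map and of its inverse,
  and with it the push-forward of the cone measure, is glued from sectors.\<close>

lemma Ck_on_subset: "Ck_on k S f \<Longrightarrow> T \<subseteq> S \<Longrightarrow> Ck_on k T f"
  by (induction k arbitrary: f) (auto intro: continuous_on_subset)

text \<open>On an open set derivatives depend only on nearby values. This matters because
  \<open>chart_inv\<close> is built from \<open>inv_into\<close> and is arbitrary off the image, so
  maps written in a restricted chart agree with the original ones only on the image.\<close>

lemma Ck_on_cong_open:
  assumes "open S" "\<And>x. x \<in> S \<Longrightarrow> f x = h x" "Ck_on k S f"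
  shows "Ck_on k S h"
  using assms(2,3)
proof (induction k arbitrary: f h)
  case 0
  then show ?case by (simp cong: continuous_on_cong)
next
  case (Suc k)
  have "h differentiable at x" if "x \<in> S" for x
    using Suc.prems that \<open>open S\<close>
    by (meson Ck_on.simps(2) differentiable_def has_derivative_transform_within_open)
  moreover have "Ck_on k S (\<lambda>x. frechet_derivative h (at x) v)" for v
  proof (rule Suc.IH)
    show "Ck_on k S (\<lambda>x. frechet_derivative f (at x) v)"
      using Suc.prems by simp
    show "frechet_derivative f (at x) v = frechet_derivative h (at x) v" if "x \<in> S" for x
      using frechet_derivative_transform_within_open[of f x S h] Suc.prems that \<open>open S\<close> by simp
  qed
  ultimately show ?case by simp
qed

lemma smooth_on_imp_continuous_on: "smooth_on S f \<Longrightarrow> continuous_on S f"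
  unfolding smooth_on_def by (metis Ck_on.simps(1))

lemma chart_inv_left:
  assumes "is_chart M c" "b \<in> fst c"
  shows "chart_inv c (snd c b) = b"
  using assms by (auto simp: is_chart_def homeomorphism_def)

lemma is_chart_inj: "is_chart M c \<Longrightarrow> inj_on (snd c) (fst c)"
  by (metis chart_inv_left inj_onI)

lemma is_chart_continuous: "is_chart M c \<Longrightarrow> continuous_on (fst c) (snd c)"
  by (simp add: is_chart_def homeomorphism_def)

lemma is_chart_inv_continuous: "is_chart M c \<Longrightarrow> continuous_on (snd c ` fst c) (chart_inv c)"
  by (simp add: is_chart_def homeomorphism_def)

lemma is_chart_open_image:
  assumes "is_chart M c" "openin (top_of_set M) V"
  shows "open (snd c ` (fst c \<inter> V))"
proof -
  have "openin (top_of_set (fst c)) (fst c \<inter> V)"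
    using assms unfolding is_chart_def
    by (meson inf.cobounded1 openin_Int openin_imp_subset openin_subset_trans)
  then have "openin (top_of_set (snd c ` fst c)) (snd c ` (fst c \<inter> V))"
    using assms homeomorphism_imp_open_map unfolding is_chart_def by blast
  then show ?thesis
    using assms openin_open_trans unfolding is_chart_def by blast
qed

lemma smooth_surface_chart: "smooth_surface B A \<Longrightarrow> c \<in> A \<Longrightarrow> is_chart B c"
  by (simp add: smooth_surface_def smooth_atlas_def)

lemma smooth_surface_cover:
  assumes "smooth_surface B A" "b \<in> B"
  obtains c where "c \<in> A" "b \<in> fst c"
  using assms by (auto simp: smooth_surface_def smooth_atlas_def)

text \<open>Maximality of the atlas: the restricted chart is compatible with all charts of
  \<open>A\<close>, so it already belongs to \<open>A\<close>. It is the source of charts for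
  \<open>atlas_on\<close>, which keeps only those with domain inside the given open set.\<close>

lemma smooth_surface_restrict_chart:
  assumes surf: "smooth_surface B A" and c: "c \<in> A" and V: "openin (top_of_set B) V"
  shows "(fst c \<inter> V, snd c) \<in> A"
proof -
  let ?c = "(fst c \<inter> V, snd c)"
  have chart: "is_chart B c"
    using surf c by (rule smooth_surface_chart)
  have inv: "chart_inv ?c y = chart_inv c y" if "y \<in> snd c ` (fst c \<inter> V)" for y
    using that chart_inv_left[OF chart] is_chart_inj[OF chart]
    by (auto simp: chart_inv_def inv_into_f_f inj_on_Int)
  have "is_chart B ?c"
    unfolding is_chart_def
  proof (intro conjI)
    show "openin (top_of_set B) (fst ?c)"
      using chart V by (simp add: is_chart_def openin_Int)
    show "open (snd ?c ` fst ?c)"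
      using is_chart_open_image[OF chart V] by simp
    have "homeomorphism (fst c \<inter> V) (snd c ` (fst c \<inter> V)) (snd c) (chart_inv c)"
      using chart unfolding is_chart_def
      by (elim conjE homeomorphism_of_subsets) auto
    then show "homeomorphism (fst ?c) (snd ?c ` fst ?c) (snd ?c) (chart_inv ?c)"
      by (rule homeomorphism_cong) (auto simp: inv)
  qed
  moreover have "compatible ?c d" if d: "d \<in> A" for d
  proof -
    have cd: "compatible c d"
      using surf c d by (simp add: smooth_surface_def smooth_atlas_def)
    have smooth: "Ck_on k (snd c ` (fst c \<inter> V \<inter> fst d)) (snd d \<circ> chart_inv c)"
      "Ck_on k (snd d ` (fst c \<inter> V \<inter> fst d)) (snd c \<circ> chart_inv d)" for k
    proof -
      have "Ck_on k (snd c ` (fst c \<inter> fst d)) (snd d \<circ> chart_inv c)"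
        "Ck_on k (snd d ` (fst c \<inter> fst d)) (snd c \<circ> chart_inv d)"
        using cd by (simp_all add: compatible_def smooth_on_def)
      then show "Ck_on k (snd c ` (fst c \<inter> V \<inter> fst d)) (snd d \<circ> chart_inv c)"
        "Ck_on k (snd d ` (fst c \<inter> V \<inter> fst d)) (snd c \<circ> chart_inv d)"
        by (auto elim!: Ck_on_subset)
    qed
    have d': "openin (top_of_set B) (fst d)"
      using smooth_surface_chart[OF surf d] by (simp add: is_chart_def)
    have op: "open (snd c ` (fst c \<inter> V \<inter> fst d))"
      using is_chart_open_image[OF chart openin_Int[OF V d']] by (simp add: Int_assoc)
    have "smooth_on (snd c ` (fst c \<inter> V \<inter> fst d)) (snd d \<circ> chart_inv ?c)"
      unfolding smooth_on_def
    proof (rule allI, rule Ck_on_cong_open[OF op])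
      fix k
      show "Ck_on k (snd c ` (fst c \<inter> V \<inter> fst d)) (snd d \<circ> chart_inv c)"
        by (rule smooth)
    qed (auto simp: inv)
    moreover have "smooth_on (snd d ` (fst c \<inter> V \<inter> fst d)) (snd c \<circ> chart_inv d)"
      unfolding smooth_on_def by (intro allI smooth)
    ultimately show ?thesis by (simp add: compatible_def)
  qed
  ultimately show ?thesis
    using surf by (simp add: smooth_surface_def)
qed

text \<open>Continuity is local. The lemma is the gluing device for maps controlled only chart by
  chart or sector by sector.\<close>

lemma continuous_on_openin_cover:
  fixes f :: "'a::t2_space \<Rightarrow> 'b::topological_space"
  assumes "\<And>x. x \<in> S \<Longrightarrow> \<exists>U. openin (top_of_set S) U \<and> x \<in> U \<and> continuous_on U f"
  shows "continuous_on S f"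
  unfolding continuous_on_eq_continuous_within
proof (rule ballI)
  fix x assume x: "x \<in> S"
  then obtain U where U: "openin (top_of_set S) U" "x \<in> U" "continuous_on U f"
    using assms by blast
  then obtain T where T: "open T" "U = S \<inter> T"
    by (auto simp: openin_open)
  have "continuous (at x within U) f"
    using U by (simp add: continuous_on_eq_continuous_within)
  then show "continuous (at x within S) f"
    using T U at_within_nhd[of x T "S \<inter> T" S] by (simp add: continuous_within Int_absorb2) 
qed

lemma smooth_fun_continuous_on:
  assumes surf: "smooth_surface B A" and f: "smooth_fun A f"
  shows "continuous_on B f"
proof (rule continuous_on_openin_cover)
  fix x assume "x \<in> B"
  then obtain c where c: "c \<in> A" "x \<in> fst c"
    using surf by (meson smooth_surface_cover)
  have chart: "is_chart B c"
    using surf c(1) by (rule smooth_surface_chart)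
  have "continuous_on (snd c ` fst c) (f \<circ> chart_inv c)"
    using f c(1) smooth_on_imp_continuous_on unfolding smooth_fun_def by blast
  then have "continuous_on (fst c) ((f \<circ> chart_inv c) \<circ> snd c)"
    by (rule continuous_on_compose[OF is_chart_continuous[OF chart]])
  then have "continuous_on (fst c) f"
    using chart_inv_left[OF chart] by (simp cong: continuous_on_cong)
  then show "\<exists>U. openin (top_of_set B) U \<and> x \<in> U \<and> continuous_on U f"
    using chart c(2) unfolding is_chart_def by blast
qed

section \<open>Supports and bounds of test functions\<close>

lemma in_support: "b \<in> M \<Longrightarrow> f b \<noteq> 0 \<Longrightarrow> b \<in> support_in M f"
  using closure_subset[of "{x \<in> M. f x \<noteq> 0}"] by (auto simp: support_in_def)

lemma support_in_subset: "support_in M f \<subseteq> M"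
  by (simp add: support_in_def)

text \<open>Compactness bounds \<open>f\<close> on its support, and on the rest of \<open>B\<close>
  it vanishes. Off \<open>B\<close> the values of \<open>f\<close> are unconstrained, hence the
  restriction of the bound to \<open>B\<close>.\<close>

lemma test_function_bounded:
  assumes surf: "smooth_surface B A" and f: "test_function B A f"
  obtains C where "0 \<le> C" "\<And>b. b \<in> B \<Longrightarrow> \<bar>f b\<bar> \<le> C"
proof -
  have "continuous_on (support_in B f) f"
    using f smooth_fun_continuous_on[OF surf] support_in_subset
    by (metis continuous_on_subset test_function_def)
  then have "bounded (f ` support_in B f)"
    using f compact_continuous_image compact_imp_bounded unfolding test_function_def by blast
  then obtain C where C: "\<And>b. b \<in> support_in B f \<Longrightarrow> \<bar>f b\<bar> \<le> C"
    unfolding bounded_iff by auto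
  show ?thesis
  proof (rule that)
    \<comment> \<open>For an empty support \<open>C\<close> is an arbitrary real, possibly negative;
      the maximum with 0 covers this.\<close>
    show "\<bar>f b\<bar> \<le> max 0 C" if "b \<in> B" for b
      using C[of b] in_support[OF that, of f] by (cases "f b = 0") auto
  qed auto
qed

section \<open>Kernels and integration\<close>

text \<open>Second countability identifies the Borel sets of the product space with the product of
  the Borel sigma-algebras, so joint continuity on \<open>M \<times> N\<close> gives measurability
  for the pair measure.\<close>

lemma borel_measurable_pair_continuous_on:
  fixes M :: "'a::second_countable_topology set" and N :: "'b::second_countable_topology set"
  assumes cont: "continuous_on (M \<times> N) f"
    and \<mu>: "sets \<mu> = sets (restrict_space borel M)" and \<nu>: "sets \<nu> = sets (restrict_space borel N)"
  shows "f \<in> borel_measurable (\<mu> \<Otimes>\<^sub>M \<nu>)"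
proof -
  have sp: "space \<mu> = M" "space \<nu> = N"
    using sets_eq_imp_space_eq[OF \<mu>] sets_eq_imp_space_eq[OF \<nu>] by (simp_all add: space_restrict_space)
  have 1: "(\<lambda>x. x) \<in> \<mu> \<rightarrow>\<^sub>M borel"
    using measurable_restrict_space1[OF measurable_ident, of borel M]
    by (simp add: measurable_cong_sets[OF \<mu> refl] id_def)
  have 2: "(\<lambda>x. x) \<in> \<nu> \<rightarrow>\<^sub>M borel"
    using measurable_restrict_space1[OF measurable_ident, of borel N]
    by (simp add: measurable_cong_sets[OF \<nu> refl] id_def)
  have "(\<lambda>z. (fst z, snd z)) \<in> \<mu> \<Otimes>\<^sub>M \<nu> \<rightarrow>\<^sub>M borel \<Otimes>\<^sub>M borel"
    by (intro measurable_Pair measurable_compose[OF measurable_fst 1] measurable_compose[OF measurable_snd 2])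
  then have "(\<lambda>z. z) \<in> \<mu> \<Otimes>\<^sub>M \<nu> \<rightarrow>\<^sub>M (borel :: ('a \<times> 'b) measure)"
    by (simp add: borel_prod)
  then have "(\<lambda>z. z) \<in> \<mu> \<Otimes>\<^sub>M \<nu> \<rightarrow>\<^sub>M restrict_space borel (M \<times> N)"
    by (rule measurable_restrict_space2[rotated]) (auto simp: space_pair_measure sp)
  from measurable_compose[OF this borel_measurable_continuous_on_restrict[OF cont]]
  show ?thesis by simp
qed

lemma heat_kernel_measurable:
  fixes M :: "'a::second_countable_topology set"
  assumes "heat_kernel M A g \<mu> K" "sets \<mu> = sets (restrict_space borel M)" "0 < t"
  shows "(\<lambda>(b, b'). K b b' t) \<in> borel_measurable (\<mu> \<Otimes>\<^sub>M \<mu>)"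
  using assms by (intro borel_measurable_pair_continuous_on) (auto simp: heat_kernel_def)

lemma heat_kernel_integrable_indicator:
  fixes M :: "'a::second_countable_topology set"
  assumes K: "heat_kernel M A g \<mu> K" and \<mu>: "sets \<mu> = sets (restrict_space borel M)" and "0 < t"
    and sf: "sigma_finite_measure \<mu>" and S: "S \<in> sets \<mu>" "emeasure \<mu> S < \<infinity>"
  shows "integrable (\<mu> \<Otimes>\<^sub>M \<mu>) (\<lambda>(b, b'). K b b' t * (indicator S b * indicator S b'))"
proof -
  interpret sigma_finite_measure \<mu> by fact
  interpret pair_sigma_finite \<mu> \<mu> ..
  let ?i = "indicator S :: 'a \<Rightarrow> real"
  have sp: "space \<mu> = M"
    using sets_eq_imp_space_eq[OF \<mu>] by (simp add: space_restrict_space)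
  have meas[measurable]: "(\<lambda>(b, b'). K b b' t) \<in> borel_measurable (\<mu> \<Otimes>\<^sub>M \<mu>)"
    using heat_kernel_measurable[OF K \<mu> \<open>0 < t\<close>] .
  note S(1)[measurable]
  have i2: "(?i x)\<^sup>2 = ?i x" for x by (simp add: indicator_def)
  have int_i: "integrable \<mu> ?i"
    using S by simp
  have iL2: "?i \<in> L2 \<mu>"
    using int_i S(1) by (simp add: L2_def i2)
  have TL2: "kernel_op \<mu> K t ?i \<in> L2 \<mu>"
    using K iL2 \<open>0 < t\<close> unfolding heat_kernel_def C0_semigroup_def by blast
  have ae: "AE b in \<mu>. integrable \<mu> (\<lambda>b'. K b b' t * ?i b')"
    using K iL2 \<open>0 < t\<close> unfolding heat_kernel_def by blast
  have nn: "0 \<le> K b b' t" if "b \<in> space \<mu>" "b' \<in> space \<mu>" for b b'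
    using K that \<open>0 < t\<close> unfolding sp heat_kernel_def by blast
  show ?thesis
  proof (rule Fubini_integrable)
    show "(\<lambda>(b, b'). K b b' t * (?i b * ?i b')) \<in> borel_measurable (\<mu> \<Otimes>\<^sub>M \<mu>)"
      by measurable
    show "AE x in \<mu>. integrable \<mu> (\<lambda>y. case (x, y) of (b, b') \<Rightarrow> K b b' t * (?i b * ?i b'))"
      using ae
    proof eventually_elim
      case (elim x)
      then have "integrable \<mu> (\<lambda>b'. ?i x * (K x b' t * ?i b'))"
        by (rule integrable_mult_right)
      then show ?case by (simp add: ac_simps)
    qed
    have Tm: "kernel_op \<mu> K t ?i \<in> borel_measurable \<mu>" "integrable \<mu> (\<lambda>x. (kernel_op \<mu> K t ?i x)\<^sup>2)"
      using TL2 by (auto simp: L2_def)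
    \<comment> \<open>Stands in for Cauchy-Schwarz: with \<open>a\<close> the value of the heat
      operator on the indicator, \<open>\<bar>a\<bar> \<le> a\<^sup>2 + 1\<close> on
      \<open>S\<close>, and both terms are integrable because \<open>a\<close> is square integrable
      and \<open>S\<close> has finite measure.\<close>
    have "integrable \<mu> (\<lambda>x. (kernel_op \<mu> K t ?i x)\<^sup>2 + ?i x)"
      using Tm int_i by simp
    then have "integrable \<mu> (\<lambda>x. kernel_op \<mu> K t ?i x * ?i x)"
    proof (rule Bochner_Integration.integrable_bound)
      show "AE x in \<mu>. norm (kernel_op \<mu> K t ?i x * ?i x) \<le> norm ((kernel_op \<mu> K t ?i x)\<^sup>2 + ?i x)"
      proof (rule AE_I2)
        fix x
        have "\<bar>a\<bar> \<le> a\<^sup>2 + 1" for a :: real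
          using zero_le_power2[of "\<bar>a\<bar> - 1"] zero_le_power2[of a] unfolding power2_diff by simp
        then show "norm (kernel_op \<mu> K t ?i x * ?i x) \<le> norm ((kernel_op \<mu> K t ?i x)\<^sup>2 + ?i x)"
          by (simp add: indicator_def)
      qed
    qed (use Tm in measurable)
    moreover have "(\<integral>y. norm (case (x, y) of (b, b') \<Rightarrow> K b b' t * (?i b * ?i b')) \<partial>\<mu>)
        = kernel_op \<mu> K t ?i x * ?i x" if x: "x \<in> space \<mu>" for x
    proof -
      have "(\<integral>y. norm (case (x, y) of (b, b') \<Rightarrow> K b b' t * (?i b * ?i b')) \<partial>\<mu>)
          = (\<integral>y. (K x y t * ?i y) * ?i x \<partial>\<mu>)"
        by (rule Bochner_Integration.integral_cong) (auto simp: abs_mult nn[OF x])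
      also have "\<dots> = kernel_op \<mu> K t ?i x * ?i x"
        by (simp add: kernel_op_def)
      finally show ?thesis .
    qed
    ultimately show "integrable \<mu> (\<lambda>x. \<integral>y. norm (case (x, y) of (b, b') \<Rightarrow> K b b' t * (?i b * ?i b')) \<partial>\<mu>)"
      by (simp cong: Bochner_Integration.integrable_cong)
  qed
qed

text \<open>The filter \<open>at_right 0\<close> is determined by positive null sequences, along
  which the usual dominated convergence theorem applies.\<close>

lemma dominated_convergence_at_right:
  fixes F :: "real \<Rightarrow> 'a \<Rightarrow> real"
  assumes meas: "\<And>\<rho>. \<rho> > 0 \<Longrightarrow> F \<rho> \<in> borel_measurable \<mu>" and F0: "F0 \<in> borel_measurable \<mu>"
    and G: "integrable \<mu> G"
    and bound: "\<And>\<rho> x. \<rho> > 0 \<Longrightarrow> x \<in> space \<mu> \<Longrightarrow> \<bar>F \<rho> x\<bar> \<le> G x"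
    and lim: "\<And>x. x \<in> space \<mu> \<Longrightarrow> ((\<lambda>\<rho>. F \<rho> x) \<longlongrightarrow> F0 x) (at_right 0)"
  shows "\<And>\<rho>. \<rho> > 0 \<Longrightarrow> integrable \<mu> (F \<rho>)" and "integrable \<mu> F0"
    and "((\<lambda>\<rho>. \<integral>x. F \<rho> x \<partial>\<mu>) \<longlongrightarrow> (\<integral>x. F0 x \<partial>\<mu>)) (at_right 0)"
proof -
  show "integrable \<mu> (F \<rho>)" if "\<rho> > 0" for \<rho>
    using bound[OF that]
    by (intro Bochner_Integration.integrable_bound[OF G meas[OF that]]) force
  have seq: "integrable \<mu> F0" "(\<lambda>n. \<integral>x. F (X n) x \<partial>\<mu>) \<longlonglongrightarrow> (\<integral>x. F0 x \<partial>\<mu>)"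
    if X: "\<And>n. 0 < X n" "X \<longlonglongrightarrow> 0" for X :: "nat \<Rightarrow> real"
  proof -
    have lim': "AE x in \<mu>. (\<lambda>n. F (X n) x) \<longlonglongrightarrow> F0 x"
    proof (rule AE_I2)
      fix x assume "x \<in> space \<mu>"
      have "filterlim X (at_right 0) sequentially"
        using X less_imp_neq[OF X(1), symmetric] by (simp add: filterlim_at)
      then show "(\<lambda>n. F (X n) x) \<longlonglongrightarrow> F0 x"
        using lim[OF \<open>x \<in> space \<mu>\<close>] filterlim_compose by blast
    qed
    have b: "AE x in \<mu>. norm (F (X n) x) \<le> G x" for n
      using bound[OF X(1)] by auto
    show "integrable \<mu> F0" "(\<lambda>n. \<integral>x. F (X n) x \<partial>\<mu>) \<longlonglongrightarrow> (\<integral>x. F0 x \<partial>\<mu>)"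
      using integrable_dominated_convergence[OF F0 meas[OF X(1)] G lim' b]
        integral_dominated_convergence[OF F0 meas[OF X(1)] G lim' b] by auto
  qed
  show "integrable \<mu> F0"
    \<comment> \<open>Any positive null sequence would do here; the limit function does not depend
      on it.\<close>
    by (rule seq(1)[of "\<lambda>n. inverse (real (Suc n))"]) (simp, rule LIMSEQ_inverse_real_of_nat)
  show "((\<lambda>\<rho>. \<integral>x. F \<rho> x \<partial>\<mu>) \<longlongrightarrow> (\<integral>x. F0 x \<partial>\<mu>)) (at_right 0)"
    \<comment> \<open>The 1 is an arbitrary right end of an interval to the right of 0.\<close>
    by (rule tendsto_at_right_sequentially[of 0 1]) (auto intro: seq(2))
qed

section \<open>The Riemannian measure\<close>

lemma openin_sets_restrict_borel:
  assumes "openin (top_of_set B) S" "S \<subseteq> M" "M \<subseteq> B"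
  shows "S \<in> sets (restrict_space borel M)"
proof -
  obtain T where "open T" "S = B \<inter> T"
    using assms(1) by (auto simp: openin_open)
  then have "S = M \<inter> T"
    using assms(2,3) by blast
  then show ?thesis
    using \<open>open T\<close> by (auto simp: sets_restrict_space)
qed

lemma riemannian_metric_continuous_density:
  assumes "riemannian_metric A g" "c \<in> A"
  shows "continuous_on (snd c ` fst c) (\<lambda>x. sqrt (det (g c (chart_inv c x))))"
proof -
  have "continuous_on (snd c ` fst c) (\<lambda>x. g c (chart_inv c x))"
    using assms smooth_on_imp_continuous_on[of _ "g c \<circ> chart_inv c"]
    by (auto simp: riemannian_metric_def o_def)
  then show ?thesis
    unfolding det_2 by (intro continuous_intros)
qed

text \<open>The density is continuous, hence bounded on a closed coordinate ball inside the chart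
  image; the preimage of the open ball is the required neighborhood.\<close>

lemma riemannian_measure_finite_near:
  assumes surf: "smooth_surface B A" and M: "openin (top_of_set B) M"
    and g: "riemannian_metric (atlas_on A M) g" and \<mu>: "riemannian_measure M (atlas_on A M) g \<mu>"
    and p: "p \<in> M"
  obtains S where "openin (top_of_set B) S" "p \<in> S" "S \<subseteq> M" "S \<in> sets \<mu>" "emeasure \<mu> S < \<infinity>"
proof -
  have "M \<subseteq> B"
    using M by (rule openin_imp_subset)
  then obtain c0 where c0: "c0 \<in> A" "p \<in> fst c0"
    using surf p smooth_surface_cover by blast
  \<comment> \<open>Cutting the chart down to \<open>M\<close> puts it into
    \<open>atlas_on A M\<close>, where \<open>g\<close> and \<open>\<mu>\<close> are
    specified.\<close>
  define c where "c = (fst c0 \<inter> M, snd c0)"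
  have c: "c \<in> atlas_on A M" "p \<in> fst c"
    using smooth_surface_restrict_chart[OF surf c0(1) M] c0 p by (auto simp: c_def atlas_on_def)
  then have chart: "is_chart B c" and cM: "fst c \<subseteq> M"
    using smooth_surface_chart[OF surf] by (auto simp: atlas_on_def)
  have "open (snd c ` fst c)" "snd c p \<in> snd c ` fst c"
    using chart c(2) by (auto simp: is_chart_def)
  then obtain e where e: "e > 0" "cball (snd c p) e \<subseteq> snd c ` fst c"
    using open_contains_cball by blast
  let ?h = "\<lambda>x. sqrt (det (g c (chart_inv c x)))"
  have "continuous_on (cball (snd c p) e) ?h"
    using riemannian_metric_continuous_density[OF g c(1)] e(2) by (rule continuous_on_subset)
  then have "bounded (?h ` cball (snd c p) e)"
    by (intro compact_imp_bounded compact_continuous_image) auto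
  then obtain C where C: "\<And>x. x \<in> cball (snd c p) e \<Longrightarrow> ?h x \<le> C"
    unfolding bounded_iff by (metis abs_le_D1 image_eqI real_norm_def)
  define S where "S = fst c \<inter> snd c -` ball (snd c p) e"
  have "openin (top_of_set (fst c)) S"
    unfolding S_def by (rule continuous_openin_preimage_gen[OF is_chart_continuous[OF chart]]) simp
  then have op: "openin (top_of_set B) S"
    using chart openin_trans unfolding is_chart_def by blast
  have S: "p \<in> S" "S \<subseteq> fst c" "snd c ` S \<subseteq> cball (snd c p) e"
    using c(2) e(1) by (auto simp: S_def)
  have sets: "S \<in> sets \<mu>"
    using openin_sets_restrict_borel[OF op _ \<open>M \<subseteq> B\<close>] S cM \<mu> by (auto simp: riemannian_measure_def)
  have "emeasure \<mu> S = (\<integral>\<^sup>+x\<in>snd c ` S. ennreal (?h x) \<partial>lborel)"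
    using \<mu> c(1) sets S(2) by (auto simp: riemannian_measure_def)
  also have "\<dots> \<le> (\<integral>\<^sup>+x. ennreal C * indicator (cball (snd c p) e) x \<partial>lborel)"
    using S(3) C by (intro nn_integral_mono) (auto simp: indicator_def intro!: ennreal_leI)
  also have "\<dots> = ennreal C * emeasure lborel (cball (snd c p) e)"
    by (simp add: nn_integral_cmult_indicator)
  also have "\<dots> < \<infinity>"
    using emeasure_bounded_finite[of "cball (snd c p) e"] by (simp add: ennreal_mult_less_top)
  finally show ?thesis
    using that op S sets cM by blast
qed

text \<open>By Lindelof, the open sets of finite measure that cover \<open>M\<close> have a
  countable subcover. Sigma-finiteness is what makes Fubini available on the square of
  \<open>\<mu>\<close>.\<close>

lemma riemannian_measure_sigma_finite:
  assumes surf: "smooth_surface B A" and M: "openin (top_of_set B) M"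
    and g: "riemannian_metric (atlas_on A M) g" and \<mu>: "riemannian_measure M (atlas_on A M) g \<mu>"
  shows "sigma_finite_measure \<mu>"
proof -
  define F where "F = {S. openin (top_of_set B) S \<and> S \<in> sets \<mu> \<and> emeasure \<mu> S < \<infinity>}"
  obtain F' where F': "F' \<subseteq> F" "countable F'" "\<Union>F' = \<Union>F"
    using Lindelof_openin[of F B] unfolding F_def by blast
  have sp: "space \<mu> = M"
    using \<mu> sets_eq_imp_space_eq[of \<mu> "restrict_space borel M"]
    by (simp add: riemannian_measure_def space_restrict_space)
  have "\<Union>F = M"
  proof
    show "\<Union>F \<subseteq> M"
      using sets.sets_into_space[of _ \<mu>] sp by (auto simp: F_def)
    show "M \<subseteq> \<Union>F"
      using riemannian_measure_finite_near[OF surf M g \<mu>] unfolding F_def by blast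
  qed
  then have "\<Union>F' = space \<mu>" "F' \<subseteq> sets \<mu>" "\<forall>a\<in>F'. emeasure \<mu> a \<noteq> \<infinity>"
    using F'(1,3) sp by (auto simp: F_def)
  then show ?thesis
    using F'(2) sigma_finite_measure.intro by blast
qed

section \<open>Determinants of metrics close to a cone metric\<close>

lemma cone_matrix_component:
  "cone_matrix \<alpha> r $ 1 $ 1 = 1" "cone_matrix \<alpha> r $ 1 $ 2 = 0"
  "cone_matrix \<alpha> r $ 2 $ 1 = 0" "cone_matrix \<alpha> r $ 2 $ 2 = \<alpha>\<^sup>2 * r\<^sup>2"
  by (simp_all add: cone_matrix_def)

text \<open>\<open>matrix_inv\<close> is a choice among two-sided inverses, so exhibiting one and
  using uniqueness of inverses settles its value.\<close>

lemma matrix_inv_cone_matrix: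
  assumes "\<alpha> \<noteq> 0" "r \<noteq> 0"
  shows "matrix_inv (cone_matrix \<alpha> r) = vector [vector [1, 0], vector [0, 1 / (\<alpha>\<^sup>2 * r\<^sup>2)]]"
    (is "_ = ?N")
proof -
  have 1: "cone_matrix \<alpha> r ** ?N = mat 1" "?N ** cone_matrix \<alpha> r = mat 1"
    using assms
    by (auto simp: vec_eq_iff forall_2 matrix_matrix_mult_def sum_2 mat_def cone_matrix_component)
  have "cone_matrix \<alpha> r ** matrix_inv (cone_matrix \<alpha> r) = mat 1"
    unfolding matrix_inv_def using someI_ex[of "\<lambda>N. cone_matrix \<alpha> r ** N = mat 1 \<and> N ** cone_matrix \<alpha> r = mat 1"] 1
    by blast
  then have "?N ** (cone_matrix \<alpha> r ** matrix_inv (cone_matrix \<alpha> r)) = ?N"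
    by simp
  then show ?thesis
    by (simp add: matrix_mul_assoc 1)
qed

text \<open>For symmetric \<open>G\<close> the off-diagonal entry lowers the determinant, so
  \<open>det G\<close> is at most the product of the diagonal entries. Measured in the orthonormal
  coframe of the cone, with factor \<open>k\<close> on the angular entry, each of these is at most
  \<open>1 + \<epsilon>\<close> in absolute value.\<close>

lemma det_perturbed_cone_le:
  fixes G :: "real^2^2"
  assumes sym: "transpose G = G" and pos: "\<alpha> > 0" "r > 0"
    and le: "tensor2_norm (cone_matrix \<alpha> r) (\<lambda>i j. (G - cone_matrix \<alpha> r) $ i $ j) \<le> \<epsilon>"
  shows "det G \<le> \<alpha>\<^sup>2 * r\<^sup>2 * (1 + \<epsilon>)\<^sup>2"
proof -
  define k where "k = 1 / (\<alpha>\<^sup>2 * r\<^sup>2)"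
  define q where "q = G - cone_matrix \<alpha> r"
  have k: "k > 0" "1 / k = \<alpha>\<^sup>2 * r\<^sup>2"
    using pos by (simp_all add: k_def)
  have inv: "matrix_inv (cone_matrix \<alpha> r) = vector [vector [1, 0], vector [0, k]]"
    using matrix_inv_cone_matrix pos by (simp add: k_def)
  \<comment> \<open>The squared Frobenius norm of \<open>q\<close> in the orthonormal coframe
    \<open>dr\<close>, \<open>\<alpha> r d\<theta>\<close>.\<close>
  define s where "s = (q$1$1)\<^sup>2 + k * (q$1$2)\<^sup>2 + k * (q$2$1)\<^sup>2 + (k * q$2$2)\<^sup>2"
  have "tensor2_norm (cone_matrix \<alpha> r) (\<lambda>i j. q $ i $ j) = sqrt s"
    unfolding tensor2_norm_def inv s_def
    by (simp add: sum_2 power2_eq_square algebra_simps)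
  then have s: "sqrt s \<le> \<epsilon>"
    using le by (simp add: q_def)
  have "\<bar>q$1$1\<bar> \<le> sqrt s" "\<bar>k * q$2$2\<bar> \<le> sqrt s"
    using k(1) by (auto intro!: real_le_rsqrt simp: s_def)
  then have q: "\<bar>q$1$1\<bar> \<le> \<epsilon>" "\<bar>k * q$2$2\<bar> \<le> \<epsilon>"
    using s by linarith+
  have "q$1$1 = G$1$1 - 1" "k * q$2$2 = k * G$2$2 - 1"
    using pos by (simp_all add: q_def cone_matrix_component k_def right_diff_distrib)
  then have "\<bar>G$1$1\<bar> \<le> 1 + \<epsilon>" "\<bar>k * G$2$2\<bar> \<le> 1 + \<epsilon>"
    using q by linarith+
  then have "\<bar>G$1$1 * (k * G$2$2)\<bar> \<le> (1 + \<epsilon>) * (1 + \<epsilon>)"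
    unfolding abs_mult by (intro mult_mono) auto
  moreover have "G$1$2 = G$2$1"
    using arg_cong[OF sym, of "\<lambda>M. M $ 2 $ 1"] by (simp add: transpose_def)
  then have "k * det G = G$1$1 * (k * G$2$2) - k * (G$1$2)\<^sup>2"
    by (simp add: det_2 power2_eq_square algebra_simps)
  moreover have "0 \<le> k * (G$1$2)\<^sup>2"
    using k(1) by simp
  ultimately have "k * det G \<le> (1 + \<epsilon>)\<^sup>2"
    unfolding power2_eq_square[of "1 + \<epsilon>"] by linarith
  then show ?thesis
    using pos by (simp add: k_def field_simps)
qed

section \<open>Angular and wedge coordinates\<close>

text \<open>Rotation by \<open>- t - pi\<close> carries the branch \<open>(t, t + 2 pi)\<close> to
  the principal interval \<open>(- pi, pi)\<close>, and the cut direction \<open>cis t\<close> to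
  the negative real axis. The angle defined by a description thus becomes an explicit expression in
  \<open>Arg\<close>.\<close>

lemma cis_shift_notin_nonpos:
  assumes "t < s" "s < t + 2 * pi"
  shows "cis s * cis (- t - pi) \<notin> \<real>\<^sub>\<le>\<^sub>0" and "Arg (cis s * cis (- t - pi)) + t + pi = s"
proof -
  have 1: "cis s * cis (- t - pi) = cis (s - t - pi)"
    by (simp add: cis_mult algebra_simps)
  have 2: "Arg (cis (s - t - pi)) = s - t - pi"
    using assms by (intro Arg_cis) auto
  then show "Arg (cis s * cis (- t - pi)) + t + pi = s"
    by (simp add: 1)
  have "\<not> (Re (cis (s - t - pi)) < 0 \<and> Im (cis (s - t - pi)) = 0)"
    using 2 assms Arg_eq_pi[of "cis (s - t - pi)"] by simp
  moreover have "Re z \<noteq> 0 \<or> Im z \<noteq> 0" if "cmod z = 1" for z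
    using that by (auto simp: cmod_def)
  ultimately show "cis s * cis (- t - pi) \<notin> \<real>\<^sub>\<le>\<^sub>0"
    unfolding 1 complex_nonpos_Reals_iff using norm_cis[of "s - t - pi"]
    by (metis order_le_less)
qed

text \<open>The converse direction: off the cut, the shifted \<open>Arg\<close> is a valid angle in
  the branch. Its continuity is that of \<open>Arg\<close> off the nonpositive reals.\<close>

lemma cis_shift_Arg:
  assumes "cmod z = 1" "z * cis (- t - pi) \<notin> \<real>\<^sub>\<le>\<^sub>0"
  defines "s \<equiv> Arg (z * cis (- t - pi)) + t + pi"
  shows "t < s" "s < t + 2 * pi" "cis s = z"
proof -
  let ?w = "z * cis (- t - pi)"
  have "z \<noteq> 0"
    using assms(1) by auto
  have w: "cmod ?w = 1"
    using assms(1) by (simp add: norm_mult)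
  have "Arg ?w \<noteq> pi"
    using assms(2) Arg_eq_pi[of ?w] by (auto simp: complex_nonpos_Reals_iff)
  then show "t < s" "s < t + 2 * pi"
    using mpi_less_Arg[of ?w] Arg_le_pi[of ?w] by (auto simp: s_def)
  have "cis (Arg ?w) = ?w"
    using cis_Arg[of ?w] w \<open>z \<noteq> 0\<close> by (auto simp: sgn_div_norm)
  then have "cis s = ?w * cis (t + pi)"
    by (simp add: s_def cis_mult[symmetric] mult.assoc add.assoc)
  also have "\<dots> = z"
    by (simp add: cis_mult mult.assoc)
  finally show "cis s = z" .
qed

lemma fst_angular_chart_iff:
  "(r, z) \<in> fst (angular_chart t) \<longleftrightarrow> 0 < r \<and> cmod z = 1 \<and> z * cis (- t - pi) \<notin> \<real>\<^sub>\<le>\<^sub>0"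
proof
  assume "(r, z) \<in> fst (angular_chart t)"
  then show "0 < r \<and> cmod z = 1 \<and> z * cis (- t - pi) \<notin> \<real>\<^sub>\<le>\<^sub>0"
    using cis_shift_notin_nonpos(1) by (auto simp: angular_chart_def)
next
  assume "0 < r \<and> cmod z = 1 \<and> z * cis (- t - pi) \<notin> \<real>\<^sub>\<le>\<^sub>0"
  then show "(r, z) \<in> fst (angular_chart t)"
    unfolding angular_chart_def fst_conv
    using cis_shift_Arg[of z t] by (intro CollectI exI[of _ r] exI[of _ "Arg (z * cis (- t - pi)) + t + pi"]) simp
qed

lemma snd_angular_chart_cis:
  assumes "t < s" "s < t + 2 * pi"
  shows "snd (angular_chart t) (r, cis s) = vector [r, s]"
proof -
  have "(THE s'. t < s' \<and> s' < t + 2 * pi \<and> cis s' = cis s) = s"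
  proof (rule the_equality)
    fix s' assume s': "t < s' \<and> s' < t + 2 * pi \<and> cis s' = cis s"
    then have "Arg (cis s * cis (- t - pi)) + t + pi = s'"
      using cis_shift_notin_nonpos(2)[of t s'] by metis
    then show "s' = s"
      using cis_shift_notin_nonpos(2)[OF assms] by (rule trans[OF sym])
  qed (use assms in auto)
  then show ?thesis by (simp add: angular_chart_def)
qed

lemma snd_angular_chart:
  assumes "(r, z) \<in> fst (angular_chart t)"
  shows "snd (angular_chart t) (r, z) = vector [r, Arg (z * cis (- t - pi)) + t + pi]"
  using assms snd_angular_chart_cis[of t "Arg (z * cis (- t - pi)) + t + pi" r] cis_shift_Arg[of z t]
  unfolding fst_angular_chart_iff by simp

lemma continuous_on_angular_chart: "continuous_on (fst (angular_chart t)) (snd (angular_chart t))"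
proof -
  \<comment> \<open>Writing the coordinate vector as a combination of axis vectors lets the
    continuity rules apply.\<close>
  have "continuous_on (fst (angular_chart t))
      (\<lambda>x. fst x *\<^sub>R axis 1 1 + (Arg (snd x * cis (- t - pi)) + t + pi) *\<^sub>R (axis 2 1 :: real^2))"
    by (intro continuous_intros) (auto simp: fst_angular_chart_iff)
  moreover have "fst x *\<^sub>R axis 1 1 + (Arg (snd x * cis (- t - pi)) + t + pi) *\<^sub>R (axis 2 1 :: real^2)
      = snd (angular_chart t) x" if "x \<in> fst (angular_chart t)" for x
    using snd_angular_chart[of "fst x" "snd x" t] that
    by (auto simp: vec_eq_iff forall_2 axis_def)
  ultimately show ?thesis
    by (simp cong: continuous_on_cong)
qed

lemma openin_angular_chart:
  assumes "E \<subseteq> cone_space"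
  shows "openin (top_of_set E) (E \<inter> fst (angular_chart t))"
proof -
  have "open {x :: cone_point. snd x * cis (- t - pi) \<notin> \<real>\<^sub>\<le>\<^sub>0}"
  proof -
    have "open ((\<lambda>x :: cone_point. snd x * cis (- t - pi)) -` (- \<real>\<^sub>\<le>\<^sub>0))"
      by (intro open_vimage continuous_intros) (simp add: open_Compl)
    then show ?thesis by (simp add: vimage_def)
  qed
  moreover have "E \<inter> fst (angular_chart t) = E \<inter> {x. snd x * cis (- t - pi) \<notin> \<real>\<^sub>\<le>\<^sub>0}"
    using assms by (auto simp: fst_angular_chart_iff cone_space_def)
  ultimately show ?thesis
    by (auto simp: openin_open)
qed

text \<open>The branch with \<open>t = 0\<close> is cut along the direction 1 and the branch with
  \<open>t = - pi\<close> along -1; no unit complex number lies on both cuts.\<close>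

lemma angular_charts_cover:
  assumes "x \<in> cone_space"
  shows "x \<in> fst (angular_chart 0) \<or> x \<in> fst (angular_chart (- pi))"
proof -
  obtain r z where x: "x = (r, z)" "0 < r" "cmod z = 1"
    using assms by (cases x) (auto simp: cone_space_def)
  have "z \<noteq> 0" using x(3) by auto
  have "z \<notin> \<real>\<^sub>\<le>\<^sub>0 \<or> - z \<notin> \<real>\<^sub>\<le>\<^sub>0"
    using \<open>z \<noteq> 0\<close> by (auto simp: complex_nonpos_Reals_iff complex_eq_iff)
  moreover have "cis (- pi) = -1" by (simp add: complex_eq_iff)
  ultimately show ?thesis
    using x by (auto simp: fst_angular_chart_iff)
qed

section \<open>Regularity of the wedge coordinates\<close>

lemma wedge_systemD:
  assumes "wedge_system B A D W" "p \<in> D"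
  shows "openin (top_of_set B) (nbhd W p)" "nbhd W p \<inter> D = {p}"
    "bij_betw (wedge_map W p) (pnbhd W p) ({0<..<rad0 W} \<times> sphere 0 1)"
    "wedge_coord W p t \<in> A" "0 < rad0 W"
  using assms by (auto simp: wedge_system_def)

lemma openin_Diff_finite:
  fixes B D :: "'a::t2_space set"
  assumes "finite D"
  shows "openin (top_of_set B) (B - D)"
  using assms by (metis finite_imp_closed openin_diff closedin_closed_Int Diff_Int2 Diff_Int_distrib2 Int_absorb openin_open Diff_eq open_Compl)

lemma pnbhd_openin:
  fixes B D :: "'a::t2_space set"
  assumes W: "wedge_system B A D W" and p: "p \<in> D"
  shows "openin (top_of_set B) (pnbhd W p)" "pnbhd W p \<subseteq> B - D"
proof -
  have n: "openin (top_of_set B) (nbhd W p)" "nbhd W p \<inter> D = {p}"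
    using wedge_systemD[OF W p] by auto
  show "pnbhd W p \<subseteq> B - D"
    using n openin_imp_subset[OF n(1)] by (auto simp: pnbhd_def)
  have "pnbhd W p = nbhd W p \<inter> (B - {p})"
    using openin_imp_subset[OF n(1)] by (auto simp: pnbhd_def)
  then show "openin (top_of_set B) (pnbhd W p)"
    using n(1) by (simp add: openin_Int openin_Diff_finite)
qed

lemma wedge_map_in:
  assumes "wedge_system B A D W" "p \<in> D" "b \<in> pnbhd W p"
  shows "wedge_map W p b \<in> {0<..<rad0 W} \<times> sphere 0 1" "wedge_map W p b \<in> cone_space"
    "0 < rad W p b" "rad W p b < rad0 W"
proof -
  show "wedge_map W p b \<in> {0<..<rad0 W} \<times> sphere 0 1"
    using wedge_systemD(3)[OF assms(1,2)] assms(3) by (auto simp: bij_betw_def)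
  then show "wedge_map W p b \<in> cone_space" "0 < rad W p b" "rad W p b < rad0 W"
    by (auto simp: wedge_map_def cone_space_def)
qed

lemma wedge_coord_angular:
  assumes "b \<in> fst (wedge_coord W p t)"
  obtains s where "t < s" "s < t + 2 * pi" "wedge_map W p b = (rad W p b, cis s)"
    "snd (wedge_coord W p t) b = vector [rad W p b, s]"
proof -
  have "(rad W p b, ang W p b) \<in> fst (angular_chart t)"
    using assms by (simp add: wedge_coord_def wedge_map_def)
  then obtain s where s: "t < s" "s < t + 2 * pi" "ang W p b = cis s"
    by (auto simp: angular_chart_def)
  then show ?thesis
    using that[OF s(1,2)] snd_angular_chart_cis[OF s(1,2)] by (simp add: wedge_coord_def wedge_map_def)
qed

lemma wedge_coord_subset: "fst (wedge_coord W p t) \<subseteq> pnbhd W p"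
  by (auto simp: wedge_coord_def)

lemma wedge_coords_cover:
  assumes "wedge_system B A D W" "p \<in> D" 
  shows "pnbhd W p = fst (wedge_coord W p 0) \<union> fst (wedge_coord W p (- pi))"
  using angular_charts_cover[OF wedge_map_in(2)[OF assms]] by (auto simp: wedge_coord_def)

lemma wedge_coord_chart:
  assumes "smooth_surface B A" "wedge_system B A D W" "p \<in> D"
  shows "is_chart B (wedge_coord W p t)"
  using smooth_surface_chart[OF assms(1) wedge_systemD(4)[OF assms(2,3)]] .

text \<open>On each sector the wedge map is \<open>(x1, cis x2)\<close> in terms of the coordinates
  \<open>x\<close> of a chart of the atlas, and the sectors are relatively open and cover the
  punctured neighborhood.\<close>

lemma continuous_on_wedge_map:
  fixes B D :: "'a::{t2_space, second_countable_topology} set"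
  assumes surf: "smooth_surface B A" and W: "wedge_system B A D W" and p: "p \<in> D"
  shows "continuous_on (pnbhd W p) (wedge_map W p)"
proof (rule continuous_on_openin_cover)
  fix b assume "b \<in> pnbhd W p"
  then obtain t where t: "b \<in> fst (wedge_coord W p t)"
    using wedge_coords_cover[OF W p] by blast
  have chart: "is_chart B (wedge_coord W p t)"
    using wedge_coord_chart[OF surf W p] .
  have "continuous_on (fst (wedge_coord W p t)) (\<lambda>b. (snd (wedge_coord W p t) b $ 1, cis (snd (wedge_coord W p t) b $ 2)))"
    unfolding cis_conv_exp by (intro continuous_intros is_chart_continuous[OF chart])
  moreover have "(snd (wedge_coord W p t) b $ 1, cis (snd (wedge_coord W p t) b $ 2)) = wedge_map W p b"
    if "b \<in> fst (wedge_coord W p t)" for b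
    using that by (rule wedge_coord_angular) simp
  ultimately have "continuous_on (fst (wedge_coord W p t)) (wedge_map W p)"
    by (simp cong: continuous_on_cong)
  moreover have "openin (top_of_set (pnbhd W p)) (fst (wedge_coord W p t))"
    using chart wedge_coord_subset pnbhd_openin(1)[OF W p] openin_imp_subset openin_subset_trans
    unfolding is_chart_def by metis
  ultimately show "\<exists>U. openin (top_of_set (pnbhd W p)) U \<and> b \<in> U \<and> continuous_on U (wedge_map W p)"
    using t by blast
qed

lemma continuous_on_rad:
  fixes B D :: "'a::{t2_space, second_countable_topology} set"
  assumes "smooth_surface B A" "wedge_system B A D W" "p \<in> D"
  shows "continuous_on (pnbhd W p) (rad W p)"
  using continuous_on_fst[OF continuous_on_wedge_map[OF assms]] by (simp add: wedge_map_def)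

text \<open>On each sector the inverse is \<open>chart_inv\<close> of the wedge chart after the
  angular chart. It ensures that the \<open>distr\<close> in \<open>wedge_measure\<close> is taken
  along a measurable map.\<close>

lemma continuous_on_wedge_inv:
  fixes B D :: "'a::{t2_space, second_countable_topology} set"
  assumes surf: "smooth_surface B A" and W: "wedge_system B A D W" and p: "p \<in> D"
  shows "continuous_on ({0<..<rad0 W} \<times> sphere 0 1) (inv_into (pnbhd W p) (wedge_map W p))"
    (is "continuous_on ?E ?inv")
proof (rule continuous_on_openin_cover)
  have E: "?E \<subseteq> cone_space"
    by (auto simp: cone_space_def)
  fix x assume x: "x \<in> ?E"
  then obtain t where t: "x \<in> fst (angular_chart t)"
    using angular_charts_cover[of x] E by blast
  let ?U = "?E \<inter> fst (angular_chart t)" and ?c = "wedge_coord W p t"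
  have chart: "is_chart B ?c"
    using wedge_coord_chart[OF surf W p] .
  have bij: "bij_betw (wedge_map W p) (pnbhd W p) ?E"
    by (rule wedge_systemD(3)[OF W p])
  have inv: "snd (angular_chart t) y \<in> snd ?c ` fst ?c" "chart_inv ?c (snd (angular_chart t) y) = ?inv y"
    if y: "y \<in> ?U" for y
  proof -
    have b: "?inv y \<in> pnbhd W p" "wedge_map W p (?inv y) = y"
      using bij y by (auto simp: bij_betw_def inv_into_into f_inv_into_f)
    then have b': "?inv y \<in> fst ?c" "snd ?c (?inv y) = snd (angular_chart t) y"
      using y by (auto simp: wedge_coord_def)
    then show "snd (angular_chart t) y \<in> snd ?c ` fst ?c"
      by (metis imageI)
    show "chart_inv ?c (snd (angular_chart t) y) = ?inv y"
      using chart_inv_left[OF chart b'(1)] b'(2) by simp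
  qed
  have "continuous_on ?U (\<lambda>y. chart_inv ?c (snd (angular_chart t) y))"
    by (rule continuous_on_compose2[OF is_chart_inv_continuous[OF chart]
          continuous_on_subset[OF continuous_on_angular_chart]])
      (use inv(1) in auto)
  then have "continuous_on ?U ?inv"
    by (rule continuous_on_eq) (rule inv(2))
  then show "\<exists>U. openin (top_of_set ?E) U \<and> x \<in> U \<and> continuous_on U ?inv"
    using openin_angular_chart[OF E] x t by blast
qed

section \<open>Measure near the conic points\<close>

lemma sets_pnbhd:
  fixes B D :: "'a::t2_space set"
  assumes "wedge_system B A D W" "p \<in> D" "sets \<mu> = sets (restrict_space borel (B - D))"
  shows "pnbhd W p \<in> sets \<mu>"
  using openin_sets_restrict_borel[OF pnbhd_openin(1)[OF assms(1,2)] pnbhd_openin(2)[OF assms(1,2)]] assms(3)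
  by auto

text \<open>Two sectors cover the punctured neighborhood, and in each of them a bounded density is
  integrated over a bounded coordinate rectangle.\<close>

lemma conic_asymptotics_finite_measure:
  fixes B D :: "'a::{t2_space, second_countable_topology} set"
  assumes surf: "smooth_surface B A"
    and g: "riemannian_metric (atlas_on A (B - D)) g"
    and \<mu>: "riemannian_measure (B - D) (atlas_on A (B - D)) g \<mu>"
    and W: "wedge_system B A D W" and conic: "conic_asymptotics D g W \<beta>" and p: "p \<in> D"
  shows "emeasure \<mu> (pnbhd W p) < \<infinity>"
proof -
  have fin: "emeasure \<mu> (fst (wedge_coord W p t)) < \<infinity>" and sets: "fst (wedge_coord W p t) \<in> sets \<mu>" for t
  proof -
    let ?c = "wedge_coord W p t" and ?\<alpha> = "cone_par W p"
    have c: "?c \<in> atlas_on A (B - D)"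
      using wedge_systemD(4)[OF W p] wedge_coord_subset[of W p t] pnbhd_openin(2)[OF W p]
      by (auto simp: atlas_on_def)
    have chart: "is_chart B ?c"
      using wedge_coord_chart[OF surf W p] .
    have op: "openin (top_of_set B) (fst ?c)"
      using chart by (simp add: is_chart_def)
    show sets: "fst ?c \<in> sets \<mu>"
      using openin_sets_restrict_borel[OF op, of "B - D"] c \<mu>
      by (auto simp: atlas_on_def riemannian_measure_def)
    have pos: "0 < ?\<alpha>" "0 < \<beta>"
      using conic p by (auto simp: conic_asymptotics_def)
    obtain C where C: "C > 0" and
      bd: "\<And>b. b \<in> fst ?c \<Longrightarrow> tensor2_norm (cone_matrix ?\<alpha> (snd ?c b $ 1))
          (\<lambda>i j. (g ?c (chart_inv ?c (snd ?c b)) - cone_matrix ?\<alpha> (snd ?c b $ 1)) $ i $ j)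
          \<le> C * rad W p b powr \<beta>"
      using conic p unfolding conic_asymptotics_def Let_def by blast
    \<comment> \<open>As \<open>\<beta> > 0\<close> and the radius stays below
      \<open>rad0 W\<close>, this constant bounds the relative perturbation on the whole sector, not
      merely near the tip.\<close>
    define \<epsilon> where "\<epsilon> = C * rad0 W powr \<beta>"
    have \<epsilon>: "0 \<le> \<epsilon>"
      using C by (simp add: \<epsilon>_def)
    have dens: "sqrt (det (g ?c b)) \<le> ?\<alpha> * rad0 W * (1 + \<epsilon>)" if b: "b \<in> fst ?c" for b
    proof -
      have b': "b \<in> pnbhd W p"
        using b by (rule subsetD[OF wedge_coord_subset])
      note r = wedge_map_in(3,4)[OF W p b']
      have x: "snd ?c b $ 1 = rad W p b"
        using b by (rule wedge_coord_angular) simp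
      have "rad W p b powr \<beta> \<le> rad0 W powr \<beta>"
        using r pos by (intro powr_mono2) auto
      then have "C * rad W p b powr \<beta> \<le> \<epsilon>"
        using C by (simp add: \<epsilon>_def)
      then have "tensor2_norm (cone_matrix ?\<alpha> (rad W p b))
          (\<lambda>i j. (g ?c b - cone_matrix ?\<alpha> (rad W p b)) $ i $ j) \<le> \<epsilon>"
        using bd[OF b] unfolding x chart_inv_left[OF chart b] by linarith
      moreover have "transpose (g ?c b) = g ?c b"
        using g c b unfolding riemannian_metric_def by blast
      ultimately have "det (g ?c b) \<le> ?\<alpha>\<^sup>2 * (rad W p b)\<^sup>2 * (1 + \<epsilon>)\<^sup>2"
        using det_perturbed_cone_le pos(1) r(1) by blast
      also have "\<dots> \<le> ?\<alpha>\<^sup>2 * (rad0 W)\<^sup>2 * (1 + \<epsilon>)\<^sup>2"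
        using r by (intro mult_right_mono mult_left_mono power_mono) auto
      finally have "sqrt (det (g ?c b)) \<le> sqrt ((?\<alpha> * rad0 W * (1 + \<epsilon>))\<^sup>2)"
        by (simp add: power_mult_distrib)
      also have "\<dots> = ?\<alpha> * rad0 W * (1 + \<epsilon>)"
        using pos r \<epsilon> by simp
      finally show ?thesis .
    qed
    let ?box = "cbox (vector [0, t]) (vector [rad0 W, t + 2 * pi]) :: (real^2) set"
    have image: "snd ?c ` fst ?c \<subseteq> ?box"
    proof clarify
      fix b assume b: "b \<in> fst ?c"
      then have b': "b \<in> pnbhd W p"
        by (rule subsetD[OF wedge_coord_subset])
      from b obtain s where "t < s" "s < t + 2 * pi" "snd ?c b = vector [rad W p b, s]"
        by (rule wedge_coord_angular)
      then show "snd ?c b \<in> ?box"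
        using wedge_map_in(3,4)[OF W p b'] by (auto simp: mem_box_cart forall_2)
    qed
    have "emeasure \<mu> (fst ?c)
        = (\<integral>\<^sup>+x\<in>snd ?c ` fst ?c. ennreal (sqrt (det (g ?c (chart_inv ?c x)))) \<partial>lborel)"
      using \<mu> c sets unfolding riemannian_measure_def by blast
    also have "\<dots> \<le> (\<integral>\<^sup>+x. ennreal (?\<alpha> * rad0 W * (1 + \<epsilon>)) * indicator ?box x \<partial>lborel)"
      using image dens chart_inv_left[OF chart]
      by (intro nn_integral_mono) (auto simp: indicator_def intro!: ennreal_leI)
    also have "\<dots> = ennreal (?\<alpha> * rad0 W * (1 + \<epsilon>)) * emeasure lborel ?box"
      by (simp add: nn_integral_cmult_indicator)
    also have "\<dots> < \<infinity>"
      using emeasure_bounded_finite[of ?box] by (simp add: ennreal_mult_less_top)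
    finally show "emeasure \<mu> (fst ?c) < \<infinity>" .
  qed
  have "emeasure \<mu> (pnbhd W p) \<le> emeasure \<mu> (fst (wedge_coord W p 0)) + emeasure \<mu> (fst (wedge_coord W p (- pi)))"
    unfolding wedge_coords_cover[OF W p] by (intro emeasure_subadditive sets)
  also have "\<dots> < \<infinity>"
    using fin by simp
  finally show ?thesis .
qed

text \<open>Every point of \<open>T\<close> has a neighborhood whose regular part has finite
  measure: the wedge neighborhood at a tip, a small coordinate ball elsewhere. A finite subcover
  then bounds the measure.\<close>

lemma finite_measure_compact:
  fixes B D :: "'a::{t2_space, second_countable_topology} set"
  assumes surf: "smooth_surface B A" and D: "finite D"
    and g: "riemannian_metric (atlas_on A (B - D)) g"
    and \<mu>: "riemannian_measure (B - D) (atlas_on A (B - D)) g \<mu>"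
    and W: "wedge_system B A D W" and conic: "conic_asymptotics D g W \<beta>"
    and T: "compact T" "T \<subseteq> B"
  shows "T \<inter> (B - D) \<in> sets \<mu>" "emeasure \<mu> (T \<inter> (B - D)) < \<infinity>"
proof -
  have sets: "sets \<mu> = sets (restrict_space borel (B - D))"
    using \<mu> by (simp add: riemannian_measure_def)
  have closed: "T \<in> sets borel"
    using compact_imp_closed[OF T(1)] by simp
  show meas: "T \<inter> (B - D) \<in> sets \<mu>"
    unfolding sets sets_restrict_space using closed by blast
  \<comment> \<open>Ambient open sets are used, as compactness of \<open>T\<close> refers to them;
    only their traces on \<open>B - D\<close> are measured.\<close>
  define F where "F = {V. open V \<and> V \<inter> (B - D) \<in> sets \<mu> \<and> emeasure \<mu> (V \<inter> (B - D)) < \<infinity>}"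
  have "\<exists>V\<in>F. b \<in> V" if b: "b \<in> T" for b
  proof -
    have "\<exists>S. openin (top_of_set B) S \<and> b \<in> S \<and> S \<inter> (B - D) \<in> sets \<mu> \<and> emeasure \<mu> (S \<inter> (B - D)) < \<infinity>"
    proof (cases "b \<in> D")
      case True
      have "nbhd W b \<inter> (B - D) = pnbhd W b"
        using wedge_systemD(1,2)[OF W True] openin_imp_subset[OF wedge_systemD(1)[OF W True]] pnbhd_openin(2)[OF W True]
        by (auto simp: pnbhd_def)
      then show ?thesis
        using wedge_systemD(1,2)[OF W True] sets_pnbhd[OF W True sets]
          conic_asymptotics_finite_measure[OF surf g \<mu> W conic True]
        by (intro exI[of _ "nbhd W b"]) auto
    next
      case False
      then have "b \<in> B - D"
        using b T by blast
      then obtain S where S: "openin (top_of_set B) S" "b \<in> S" "S \<subseteq> B - D" "S \<in> sets \<mu>" "emeasure \<mu> S < \<infinity>"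
        using riemannian_measure_finite_near[OF surf openin_Diff_finite[OF D] g \<mu>] by metis
      moreover have "S \<inter> (B - D) = S"
        using S(3) by blast
      ultimately show ?thesis
        by metis
    qed
    then obtain S where S: "openin (top_of_set B) S" "b \<in> S" "S \<inter> (B - D) \<in> sets \<mu>" "emeasure \<mu> (S \<inter> (B - D)) < \<infinity>"
      by blast
    then obtain V where V: "open V" "S = B \<inter> V"
      by (auto simp: openin_open)
    then have "V \<inter> (B - D) = S \<inter> (B - D)"
      by blast
    then show ?thesis
      using S V by (auto simp: F_def)
  qed
  then obtain F' where F': "F' \<subseteq> F" "finite F'" "T \<subseteq> \<Union>F'"
    using compactE[OF T(1), of F] by (metis (mono_tags, lifting) F_def UnionI mem_Collect_eq subsetI)
  have "emeasure \<mu> (T \<inter> (B - D)) \<le> emeasure \<mu> (\<Union>V\<in>F'. V \<inter> (B - D))"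
    using F' by (intro emeasure_mono sets.finite_UN) (auto simp: F_def)
  also have "\<dots> \<le> (\<Sum>V\<in>F'. emeasure \<mu> (V \<inter> (B - D)))"
    using F' by (intro emeasure_subadditive_finite) (auto simp: F_def)
  also have "\<dots> < \<infinity>"
    using F' by (auto simp: F_def ennreal_sum_less_top)
  finally show "emeasure \<mu> (T \<inter> (B - D)) < \<infinity>" .
qed

text \<open>Restriction is carried out in one variable at a time by iterated integration. This
  passes from the truncated cone to the full cone, where the semigroup acts, at the price of an
  indicator.\<close>

lemma nn_integral_pair_restrict_space:
  assumes M: "sigma_finite_measure M" and E: "E \<in> sets M" and f: "f \<in> borel_measurable (M \<Otimes>\<^sub>M M)"
  shows "(\<integral>\<^sup>+z. f z \<partial>(restrict_space M E \<Otimes>\<^sub>M restrict_space M E)) = (\<integral>\<^sup>+z. f z * indicator (E \<times> E) z \<partial>(M \<Otimes>\<^sub>M M))"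
proof -
  interpret M: sigma_finite_measure M by fact
  let ?R = "restrict_space M E"
  have sf: "sigma_finite_measure ?R"
    using M E by (rule sigma_finite_measure_restrict_space)
  interpret R: sigma_finite_measure ?R by (fact sf)
  note f[measurable] E[measurable]
  have id: "(\<lambda>x. x) \<in> ?R \<rightarrow>\<^sub>M M"
    by (rule measurable_restrict_space1) simp
  have "(\<lambda>z. (fst z, snd z)) \<in> ?R \<Otimes>\<^sub>M ?R \<rightarrow>\<^sub>M M \<Otimes>\<^sub>M M"
    by (intro measurable_Pair measurable_compose[OF measurable_fst id] measurable_compose[OF measurable_snd id])
  then have fR: "f \<in> borel_measurable (?R \<Otimes>\<^sub>M ?R)"
    using measurable_compose[OF _ f] by simp
  have EM: "E \<inter> space M \<in> sets M"
    using E by simp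
  have "(\<integral>\<^sup>+z. f z \<partial>(?R \<Otimes>\<^sub>M ?R)) = (\<integral>\<^sup>+x. \<integral>\<^sup>+y. f (x, y) \<partial>?R \<partial>?R)"
    using R.nn_integral_fst[OF fR] by simp
  also have "\<dots> = (\<integral>\<^sup>+x. (\<integral>\<^sup>+y. f (x, y) * indicator E y \<partial>M) * indicator E x \<partial>M)"
    by (simp add: nn_integral_restrict_space[OF EM])
  also have "\<dots> = (\<integral>\<^sup>+x. \<integral>\<^sup>+y. f (x, y) * indicator (E \<times> E) (x, y) \<partial>M \<partial>M)"
    by (intro nn_integral_cong) (auto simp: indicator_def)
  also have "\<dots> = (\<integral>\<^sup>+z. f z * indicator (E \<times> E) z \<partial>(M \<Otimes>\<^sub>M M))"
    by (rule M.nn_integral_fst) measurable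
  finally show ?thesis .
qed

section \<open>The flat cone measure, its truncation and its push-forward\<close>

lemma sets_cone_measure: "sets (cone_measure \<alpha>) = sets (restrict_space borel cone_space)"
  by (simp add: cone_measure_def)

lemma space_cone_measure: "space (cone_measure \<alpha>) = cone_space"
  using sets_eq_imp_space_eq[OF sets_cone_measure] by (simp add: space_restrict_space)

lemma truncated_cone_sets:
  "{0<..<R} \<times> sphere 0 1 \<in> sets (cone_measure \<alpha>)"
proof -
  have "{0<..<R} \<times> sphere 0 1 = cone_space \<inter> ({0<..<R} \<times> sphere 0 1)"
    by (auto simp: cone_space_def)
  moreover have "{0<..<R} \<times> sphere (0::complex) 1 \<in> sets (borel :: cone_point measure)"
    by (intro borel_Times) (auto intro: borel_closed)
  ultimately show ?thesis
    unfolding sets_cone_measure sets_restrict_space by blast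
qed

text \<open>In polar coordinates the density \<open>\<alpha> * r\<close> is at most
  \<open>\<alpha> * R\<close> on a bounded rectangle, so the tip causes no divergence.\<close>

lemma truncated_cone_finite:
  assumes "0 < \<alpha>"
  shows "emeasure (cone_measure \<alpha>) ({0<..<R} \<times> sphere 0 1) < \<infinity>"
proof -
  let ?\<Omega> = "{0<..} \<times> {-pi<..pi} :: (real \<times> real) set"
  let ?L = "restrict_space lborel ?\<Omega>"
  let ?N = "density ?L (\<lambda>(r, s). ennreal (\<alpha> * r))"
  let ?f = "\<lambda>(r, s). (r, cis s)" and ?E = "{0<..<R} \<times> sphere 0 1"
  let ?box = "cbox (0, - pi) (R, pi) :: (real \<times> real) set"
  have \<Omega>: "?\<Omega> \<in> sets (borel :: (real \<times> real) measure)"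
    by (intro borel_Times) auto
  have dens[measurable]: "(\<lambda>(r, s). ennreal (\<alpha> * r)) \<in> borel_measurable (borel :: (real \<times> real) measure)"
    unfolding borel_prod[symmetric] by measurable
  have "?f \<in> borel_measurable (borel :: (real \<times> real) measure)"
    by (intro borel_measurable_continuous_onI) (simp add: case_prod_beta cis_conv_exp continuous_intros)
  then have f: "?f \<in> ?N \<rightarrow>\<^sub>M restrict_space borel cone_space"
    by (intro measurable_restrict_space2)
      (auto simp: space_restrict_space cone_space_def intro: measurable_restrict_space1)
  have E: "?E \<in> sets (restrict_space borel cone_space)"
    using truncated_cone_sets[of R] by (simp add: sets_cone_measure)
  have "emeasure (cone_measure \<alpha>) ?E = emeasure ?N (?f -` ?E \<inter> space ?N)"
    unfolding cone_measure_def using f E by (rule emeasure_distr)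
  also have "\<dots> = (\<integral>\<^sup>+x. (case x of (r, s) \<Rightarrow> ennreal (\<alpha> * r)) * indicator (?f -` ?E \<inter> space ?N) x \<partial>?L)"
    using measurable_sets[OF f E] by (intro emeasure_density measurable_restrict_space1) auto
  also have "\<dots> = (\<integral>\<^sup>+x. (case x of (r, s) \<Rightarrow> ennreal (\<alpha> * r)) * indicator (?f -` ?E \<inter> space ?N) x * indicator ?\<Omega> x \<partial>lborel)"
    using \<Omega> by (intro nn_integral_restrict_space) auto
  also have "\<dots> \<le> (\<integral>\<^sup>+x. ennreal (\<alpha> * R) * indicator ?box x \<partial>lborel)"
    using assms by (intro nn_integral_mono) (auto simp: indicator_def mem_box Basis_prod_def space_restrict_space intro!: ennreal_leI)
  also have "\<dots> = ennreal (\<alpha> * R) * emeasure lborel ?box"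
    by (simp add: nn_integral_cmult_indicator)
  also have "\<dots> < \<infinity>"
    using emeasure_bounded_finite[of ?box] by (simp add: ennreal_mult_less_top)
  finally show ?thesis .
qed

lemma sigma_finite_cone_measure:
  assumes "0 < \<alpha>"
  shows "sigma_finite_measure (cone_measure \<alpha>)"
proof
  let ?F = "range (\<lambda>n::nat. {0<..<real n} \<times> sphere (0::complex) 1)"
  have "\<Union>?F = cone_space"
    using reals_Archimedean2 by (fastforce simp: cone_space_def)
  then show "\<exists>F. countable F \<and> F \<subseteq> sets (cone_measure \<alpha>) \<and> \<Union>F = space (cone_measure \<alpha>)
      \<and> (\<forall>a\<in>F. emeasure (cone_measure \<alpha>) a \<noteq> \<infinity>)"
    using truncated_cone_sets truncated_cone_finite[OF assms] 
    by (intro exI[of _ ?F]) (auto simp: space_cone_measure less_top[symmetric])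
qed

text \<open>The image side of the wedge map: \<open>wedge_measure\<close> is the push-forward of
  this finite measure along the inverse wedge map.\<close>

abbreviation truncated_cone :: "'a wedge_charts \<Rightarrow> 'a \<Rightarrow> cone_point measure" where
  "truncated_cone W p \<equiv> restrict_space (cone_measure (cone_par W p)) ({0<..<rad0 W} \<times> sphere 0 1)"

lemma sets_truncated_cone:
  "sets (truncated_cone W p) = sets (restrict_space borel ({0<..<rad0 W} \<times> sphere 0 1))"
proof -
  have "cone_space \<inter> ({0<..<rad0 W} \<times> sphere 0 1) = {0<..<rad0 W} \<times> sphere 0 1"
    by (auto simp: cone_space_def)
  then show ?thesis
    using sets_restrict_space_cong[OF sets_cone_measure] by (simp add: sets_restrict_restrict_space)
qed

lemma space_truncated_cone: "space (truncated_cone W p) = {0<..<rad0 W} \<times> sphere 0 1"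
  by (auto simp: space_restrict_space space_cone_measure cone_space_def)

lemma finite_measure_truncated_cone:
  assumes "0 < cone_par W p"
  shows "finite_measure (truncated_cone W p)"
proof
  let ?E = "{0<..<rad0 W} \<times> sphere 0 1" and ?C = "cone_measure (cone_par W p)"
  have "emeasure (truncated_cone W p) ?E = emeasure ?C ?E"
    using truncated_cone_sets by (intro emeasure_restrict_space) auto
  then show "emeasure (truncated_cone W p) (space (truncated_cone W p)) \<noteq> \<infinity>"
    using truncated_cone_finite[OF assms] unfolding space_truncated_cone by (simp add: less_top[symmetric])
qed

lemma sets_wedge_measure: "sets (wedge_measure W p) = sets (restrict_space borel (pnbhd W p))"
  by (simp add: wedge_measure_def)

lemma space_wedge_measure: "space (wedge_measure W p) = pnbhd W p"
  by (simp add: wedge_measure_def space_restrict_space)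

text \<open>Pulling back along the inverse wedge map turns the integral into one of the cone kernel
  over the square of the truncated cone, a set of finite measure to which
  \<open>heat_kernel_integrable_indicator\<close> applies.\<close>

lemma wedge_cone_kernel_integrable:
  fixes B D :: "'a::{t2_space, second_countable_topology} set"
  assumes surf: "smooth_surface B A" and W: "wedge_system B A D W" and p: "p \<in> D"
    and \<alpha>: "0 < cone_par W p" and "0 < t"
    and Kc: "heat_kernel cone_space cone_atlas (cone_metric (cone_par W p)) (cone_measure (cone_par W p)) (Kc (cone_par W p))"
  shows "integrable (wedge_measure W p \<Otimes>\<^sub>M wedge_measure W p) (\<lambda>(b, b'). wedge_cone_kernel Kc W p b b' t)"
proof -
  let ?E = "{0<..<rad0 W} \<times> sphere (0::complex) 1"
  let ?cm = "cone_measure (cone_par W p)" and ?C = "truncated_cone W p"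
  let ?N = "restrict_space borel (pnbhd W p)" and ?inv = "inv_into (pnbhd W p) (wedge_map W p)"
  let ?k = "\<lambda>(x, y). Kc (cone_par W p) x y t"
  have E: "?E \<in> sets ?cm" "?E \<subseteq> cone_space"
    using truncated_cone_sets by (auto simp: cone_space_def)
  have kcont: "continuous_on (cone_space \<times> cone_space) ?k"
    using Kc \<open>0 < t\<close> by (auto simp: heat_kernel_def)
  have kmeas: "?k \<in> borel_measurable (?C \<Otimes>\<^sub>M ?C)"
    using E(2) by (intro borel_measurable_pair_continuous_on[of ?E ?E] sets_truncated_cone
        continuous_on_subset[OF kcont]) auto
  have kmeas': "?k \<in> borel_measurable (?cm \<Otimes>\<^sub>M ?cm)"
    using heat_kernel_measurable[OF Kc sets_cone_measure \<open>0 < t\<close>] .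
  have kC: "integrable (?C \<Otimes>\<^sub>M ?C) ?k"
  proof (rule integrableI_bounded[OF kmeas])
    have "(\<integral>\<^sup>+z. norm (?k z) \<partial>(?C \<Otimes>\<^sub>M ?C)) = (\<integral>\<^sup>+z. ennreal (norm (?k z)) * indicator (?E \<times> ?E) z \<partial>(?cm \<Otimes>\<^sub>M ?cm))"
      by (subst nn_integral_pair_restrict_space[OF sigma_finite_cone_measure[OF \<alpha>] E(1)])
        (use kmeas' in measurable)
    also have "\<dots> = (\<integral>\<^sup>+z. norm (case z of (x, y) \<Rightarrow> Kc (cone_par W p) x y t * (indicator ?E x * indicator ?E y)) \<partial>(?cm \<Otimes>\<^sub>M ?cm))"
      by (intro nn_integral_cong) (auto simp: indicator_def)
    also have "\<dots> < \<infinity>"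
      using heat_kernel_integrable_indicator[OF Kc sets_cone_measure \<open>0 < t\<close>
          sigma_finite_cone_measure[OF \<alpha>] E(1) truncated_cone_finite[OF \<alpha>]]
      unfolding integrable_iff_bounded by simp
    finally show "(\<integral>\<^sup>+z. norm (?k z) \<partial>(?C \<Otimes>\<^sub>M ?C)) < \<infinity>" .
  qed
  have inv_into: "?inv x \<in> pnbhd W p" "wedge_map W p (?inv x) = x" if "x \<in> ?E" for x
    using wedge_systemD(3)[OF W p] that by (auto simp: bij_betw_def inv_into_into f_inv_into_f)
  have "?inv \<in> borel_measurable ?C"
    using borel_measurable_continuous_on_restrict[OF continuous_on_wedge_inv[OF surf W p]]
    by (simp add: measurable_cong_sets[OF sets_truncated_cone refl])
  then have inv: "?inv \<in> ?C \<rightarrow>\<^sub>M ?N"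
    using inv_into(1) by (intro measurable_restrict_space2) (auto simp: space_truncated_cone)
  interpret C: finite_measure ?C
    using finite_measure_truncated_cone[OF \<alpha>] .
  \<comment> \<open>Finiteness of the push-forward supplies the sigma-finiteness required for the
    product of push-forwards to be the push-forward of the product.\<close>
  interpret N: finite_measure "distr ?C ?N ?inv"
    using C.finite_measure_distr[OF inv] .
  have pair: "wedge_measure W p \<Otimes>\<^sub>M wedge_measure W p
      = distr (?C \<Otimes>\<^sub>M ?C) (?N \<Otimes>\<^sub>M ?N) (\<lambda>(x, y). (?inv x, ?inv y))"
    unfolding wedge_measure_def by (rule pair_measure_distr[OF inv inv]) unfold_locales
  have wcont: "continuous_on (pnbhd W p) (wedge_map W p)"
    using continuous_on_wedge_map[OF surf W p] .
  have "continuous_on (pnbhd W p \<times> pnbhd W p) (\<lambda>z. ?k (wedge_map W p (fst z), wedge_map W p (snd z)))"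
  proof (rule continuous_on_compose2[OF kcont])
    show "continuous_on (pnbhd W p \<times> pnbhd W p) (\<lambda>z. (wedge_map W p (fst z), wedge_map W p (snd z)))"
      by (intro continuous_on_Pair continuous_on_compose2[OF wcont] continuous_on_fst continuous_on_snd continuous_on_id) auto
  qed (use wedge_map_in(2)[OF W p] in auto)
  then have wmeas: "(\<lambda>(b, b'). wedge_cone_kernel Kc W p b b' t) \<in> borel_measurable (?N \<Otimes>\<^sub>M ?N)"
    by (intro borel_measurable_pair_continuous_on[of "pnbhd W p" "pnbhd W p"])
      (auto simp: wedge_cone_kernel_def case_prod_beta)
  have pmeas: "(\<lambda>(x, y). (?inv x, ?inv y)) \<in> ?C \<Otimes>\<^sub>M ?C \<rightarrow>\<^sub>M ?N \<Otimes>\<^sub>M ?N"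
    using inv by measurable
  show ?thesis
    unfolding pair integrable_distr_eq[OF pmeas wmeas]
  proof (subst Bochner_Integration.integrable_cong[OF refl])
    fix z assume "z \<in> space (?C \<Otimes>\<^sub>M ?C)"
    then show "(case case z of (x, y) \<Rightarrow> (?inv x, ?inv y) of (b, b') \<Rightarrow> wedge_cone_kernel Kc W p b b' t) = ?k z"
      using inv_into(2) by (auto simp: space_pair_measure space_truncated_cone wedge_cone_kernel_def)
  qed (rule kC)
qed

section \<open>Cutoffs and the renormalized pairing\<close>

text \<open>Outside the compact interval \<open>[1/2, 1]\<close> only the values 0 and 1 occur.
  Positive arguments are enough because radii of regular points are positive.\<close>

lemma cutoff_profile_bounded:
  assumes "cutoff_profile \<eta>"
  obtains C where "0 \<le> C" "\<And>s. 0 < s \<Longrightarrow> \<bar>\<eta> s\<bar> \<le> C"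
proof -
  have "continuous_on {1/2..1} \<eta>"
    using assms smooth_on_imp_continuous_on[of "{0<..}" \<eta>]
    by (auto simp: cutoff_profile_def elim!: continuous_on_subset)
  then have "bounded (\<eta> ` {1/2..1})"
    by (intro compact_imp_bounded compact_continuous_image) auto
  then obtain C where C: "\<And>s. s \<in> {1/2..1} \<Longrightarrow> \<bar>\<eta> s\<bar> \<le> C"
    unfolding bounded_iff by (metis image_eqI real_norm_def)
  show ?thesis
  proof (rule that)
    show "\<bar>\<eta> s\<bar> \<le> max 1 C" if "0 < s" for s
    proof (cases "s \<in> {1/2..1}")
      case False
      then have "\<eta> s = 0 \<or> \<eta> s = 1"
        using assms that by (auto simp: cutoff_profile_def)
      then show ?thesis by auto
    qed (use C[of s] in linarith)
  qed auto
qed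

text \<open>Collects the data that the limit must not depend on: charts, cutoffs and profile. The
  final theorem interprets it twice, for the two choices being compared.\<close>

locale conic_cutoffs =
  fixes B D :: "'a::{t2_space, second_countable_topology} set" and A :: "'a chart set"
    and W :: "'a wedge_charts" and \<kappa> \<kappa>t :: "'a \<Rightarrow> 'a \<Rightarrow> real" and \<eta> :: "real \<Rightarrow> real"
  assumes surf: "smooth_surface B A" and finite_D: "finite D" and wedge: "wedge_system B A D W"
    and cut: "cutoffs B A D W \<kappa> \<kappa>t" and profile: "cutoff_profile \<eta>"
begin

lemma test_cutoff: "p \<in> D \<Longrightarrow> test_function B A (\<kappa> p)"
  using cut by (simp add: cutoffs_def)

lemma support_cutoff: "p \<in> D \<Longrightarrow> support_in B (\<kappa> p) \<subseteq> nbhd W p"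
  using cut by (simp add: cutoffs_def)

text \<open>Outside \<open>pnbhd W p\<close> the value of \<open>rad W p\<close> is meaningless;
  this vanishing removes it from every summand of \<open>eta_cut\<close>.\<close>

lemma cutoff_zero: "p \<in> D \<Longrightarrow> b \<in> B - D \<Longrightarrow> b \<notin> pnbhd W p \<Longrightarrow> \<kappa> p b = 0"
  using in_support[of b B "\<kappa> p"] support_cutoff[of p] by (auto simp: pnbhd_def)

lemma measurable_test_function:
  assumes "test_function B A f"
  shows "f \<in> borel_measurable (restrict_space borel (B - D))"
  using assms smooth_fun_continuous_on[OF surf, of f]
  by (intro borel_measurable_continuous_on_restrict) (auto simp: test_function_def elim!: continuous_on_subset)

text \<open>Each summand is continuous on the punctured neighborhood and zero on the rest of
  \<open>B - D\<close>, hence measurable as an extension by zero.\<close>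

lemma measurable_eta_cut:
  assumes "0 < \<rho>"
  shows "eta_cut D W \<kappa> \<eta> \<rho> \<in> borel_measurable (restrict_space borel (B - D))"
proof -
  let ?R = "restrict_space borel (B - D)"
  have "(\<lambda>b. (1 - \<eta> (rad W p b / \<rho>)) * \<kappa> p b) \<in> borel_measurable ?R" if p: "p \<in> D" for p
  proof -
    have cont: "continuous_on (pnbhd W p) (\<lambda>b. \<eta> (rad W p b / \<rho>))"
    proof (rule continuous_on_compose2[of "{0<..}" \<eta>])
      show "continuous_on {0<..} \<eta>"
        using profile by (simp add: cutoff_profile_def smooth_on_imp_continuous_on)
      show "continuous_on (pnbhd W p) (\<lambda>b. rad W p b / \<rho>)"
        using assms by (intro continuous_intros continuous_on_rad[OF surf wedge p]) auto
    qed (use wedge_map_in(3)[OF wedge p] assms in auto)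
    have "continuous_on (pnbhd W p) (\<kappa> p)"
      using smooth_fun_continuous_on[OF surf, of "\<kappa> p"] test_cutoff[OF p] pnbhd_openin(2)[OF wedge p]
      by (auto simp: test_function_def elim!: continuous_on_subset)
    then have "(\<lambda>b. (1 - \<eta> (rad W p b / \<rho>)) * \<kappa> p b) \<in> borel_measurable (restrict_space borel (pnbhd W p))"
      by (intro borel_measurable_continuous_on_restrict continuous_intros cont)
    moreover have "sets (restrict_space ?R (pnbhd W p)) = sets (restrict_space borel (pnbhd W p))"
      using pnbhd_openin(2)[OF wedge p] by (simp add: sets_restrict_restrict_space Int_absorb1)
    ultimately have "(\<lambda>b. (1 - \<eta> (rad W p b / \<rho>)) * \<kappa> p b) \<in> borel_measurable (restrict_space ?R (pnbhd W p))"
      by (simp cong: measurable_cong_sets)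
    moreover have "pnbhd W p \<inter> space ?R \<in> sets ?R"
      using sets_pnbhd[OF wedge p refl] by auto
    ultimately have "(\<lambda>b. indicator (pnbhd W p) b *\<^sub>R ((1 - \<eta> (rad W p b / \<rho>)) * \<kappa> p b)) \<in> borel_measurable ?R"
      by (simp add: borel_measurable_restrict_space_iff)
    moreover have "indicator (pnbhd W p) b *\<^sub>R ((1 - \<eta> (rad W p b / \<rho>)) * \<kappa> p b) = (1 - \<eta> (rad W p b / \<rho>)) * \<kappa> p b"
      if "b \<in> space ?R" for b
      using cutoff_zero[OF p, of b] that by (auto simp: indicator_def space_restrict_space)
    ultimately show ?thesis
      by (rule measurable_cong[THEN iffD1, rotated])
  qed
  then show ?thesis
    unfolding eta_cut_def by (intro borel_measurable_diff borel_measurable_sum borel_measurable_const)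
qed

text \<open>The bound is uniform in \<open>\<rho>\<close>, since rescaling the argument of
  \<open>\<eta>\<close> does not change its range of positive arguments. This makes a single
  dominating function possible.\<close>

lemma eta_cut_bounded:
  obtains C where "0 \<le> C" "\<And>\<rho> b. 0 < \<rho> \<Longrightarrow> b \<in> B - D \<Longrightarrow> \<bar>eta_cut D W \<kappa> \<eta> \<rho> b\<bar> \<le> C"
proof -
  obtain M where M: "0 \<le> M" "\<And>s. 0 < s \<Longrightarrow> \<bar>\<eta> s\<bar> \<le> M"
    using cutoff_profile_bounded[OF profile] by metis
  have "\<exists>C. 0 \<le> C \<and> (\<forall>b\<in>B. \<bar>\<kappa> p b\<bar> \<le> C)" if "p \<in> D" for p
    using test_function_bounded[OF surf test_cutoff[OF that]] by metis
  then obtain c where c: "\<And>p. p \<in> D \<Longrightarrow> 0 \<le> c p" "\<And>p b. p \<in> D \<Longrightarrow> b \<in> B \<Longrightarrow> \<bar>\<kappa> p b\<bar> \<le> c p"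
    by metis
  show ?thesis
  proof (rule that)
    show "0 \<le> 1 + (\<Sum>p\<in>D. (1 + M) * c p)"
      using M c by (intro add_nonneg_nonneg sum_nonneg mult_nonneg_nonneg) auto
    fix \<rho> b assume \<rho>: "0 < (\<rho>::real)" and b: "b \<in> B - D"
    have "\<bar>(1 - \<eta> (rad W p b / \<rho>)) * \<kappa> p b\<bar> \<le> (1 + M) * c p" if p: "p \<in> D" for p
    proof (cases "b \<in> pnbhd W p")
      case True
      then have "\<bar>\<eta> (rad W p b / \<rho>)\<bar> \<le> M"
        using wedge_map_in(3)[OF wedge p] \<rho> by (intro M) simp
      then show ?thesis
        unfolding abs_mult using c p b by (intro mult_mono) auto
    next
      case False
      then show ?thesis
        using cutoff_zero[OF p b] M(1) c(1)[OF p] by simp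
    qed
    then have "\<bar>\<Sum>p\<in>D. (1 - \<eta> (rad W p b / \<rho>)) * \<kappa> p b\<bar> \<le> (\<Sum>p\<in>D. (1 + M) * c p)"
      by (intro order_trans[OF sum_abs] sum_mono)
    then show "\<bar>eta_cut D W \<kappa> \<eta> \<rho> b\<bar> \<le> 1 + (\<Sum>p\<in>D. (1 + M) * c p)"
      unfolding eta_cut_def by linarith
  qed
qed

text \<open>At radius at least \<open>\<rho>\<close> the profile is 1 and the summand drops out. The
  comparison is asked only where the cutoff is nonzero, so that it can later be verified uniformly
  on compact supports.\<close>

lemma eta_cut_eq_1:
  assumes b: "b \<in> B - D" and \<rho>: "0 < \<rho>" and le: "\<And>p. p \<in> D \<Longrightarrow> b \<in> pnbhd W p \<Longrightarrow> \<kappa> p b \<noteq> 0 \<Longrightarrow> \<rho> \<le> rad W p b"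
  shows "eta_cut D W \<kappa> \<eta> \<rho> b = 1"
proof -
  have "(1 - \<eta> (rad W p b / \<rho>)) * \<kappa> p b = 0" if p: "p \<in> D" for p
  proof (cases "b \<in> pnbhd W p \<and> \<kappa> p b \<noteq> 0")
    case True
    then have "1 \<le> rad W p b / \<rho>"
      using le[OF p] \<rho> by simp
    then show ?thesis
      using profile by (simp add: cutoff_profile_def)
  next
    case False
    then show ?thesis
      using cutoff_zero[OF p b] by auto
  qed
  then have "(\<Sum>p\<in>D. (1 - \<eta> (rad W p b / \<rho>)) * \<kappa> p b) = 0"
    by (intro sum.neutral ballI)
  then show ?thesis
    by (simp add: eta_cut_def)
qed

lemma eventually_eta_cut:
  assumes b: "b \<in> B - D"
  shows "\<forall>\<^sub>F \<rho> in at_right 0. eta_cut D W \<kappa> \<eta> \<rho> b = 1"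
proof -
  have "\<forall>\<^sub>F \<rho> in at_right 0. \<forall>p\<in>D. b \<in> pnbhd W p \<longrightarrow> \<rho> \<le> rad W p b"
  proof (intro eventually_ball_finite finite_D ballI)
    fix p assume p: "p \<in> D"
    show "\<forall>\<^sub>F \<rho> in at_right 0. b \<in> pnbhd W p \<longrightarrow> \<rho> \<le> rad W p b"
    proof (cases "b \<in> pnbhd W p")
      case True
      then show ?thesis
        using wedge_map_in(3)[OF wedge p True] unfolding eventually_at_right_field
        by (auto intro!: exI[of _ "rad W p b"])
    qed simp
  qed
  then show ?thesis
    using eventually_at_right_less[of 0] by eventually_elim (auto intro!: eta_cut_eq_1[OF b])
qed

text \<open>Here the threshold for \<open>\<rho>\<close> must be uniform in the point. The support
  of \<open>f\<close> avoids the tips, so the radius attains a positive minimum on its compact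
  intersection with the support of each cutoff, and there are finitely many tips.\<close>

lemma eventually_inner_part_eq_0:
  assumes f: "test_function B A f" and supp: "support_in B f \<subseteq> B - D"
  shows "\<forall>\<^sub>F \<rho> in at_right 0. \<forall>b\<in>B. inner_part D W \<kappa> \<eta> \<rho> f b = 0"
proof -
  have "\<exists>r>0. \<forall>b\<in>support_in B (\<kappa> p) \<inter> support_in B f. r \<le> rad W p b" (is "\<exists>r>0. \<forall>b\<in>?T. _") if p: "p \<in> D" for p
  proof (cases "?T = {}")
    case False
    have "compact ?T"
      using test_cutoff[OF p] f by (auto simp: test_function_def intro: compact_Int)
    moreover have sub: "?T \<subseteq> pnbhd W p"
      using support_cutoff[OF p] p supp by (auto simp: pnbhd_def)
    then have "continuous_on ?T (rad W p)"
      using continuous_on_rad[OF surf wedge p] continuous_on_subset by blast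
    ultimately obtain b where "b \<in> ?T" "\<forall>b'\<in>?T. rad W p b \<le> rad W p b'"
      using continuous_attains_inf[of ?T "rad W p"] False by blast
    then show ?thesis
      using wedge_map_in(3)[OF wedge p] sub by (metis subsetD)
  qed (auto intro: exI[of _ 1])
  then obtain r where r: "\<And>p. p \<in> D \<Longrightarrow> 0 < r p"
    "\<And>p b. p \<in> D \<Longrightarrow> b \<in> support_in B (\<kappa> p) \<Longrightarrow> b \<in> support_in B f \<Longrightarrow> r p \<le> rad W p b"
    by (metis IntI)
  have "\<forall>\<^sub>F \<rho> in at_right 0. \<forall>p\<in>D. \<rho> \<le> r p"
  proof (intro eventually_ball_finite finite_D ballI)
    fix p assume p: "p \<in> D"
    show "\<forall>\<^sub>F \<rho> in at_right 0. \<rho> \<le> r p"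
      unfolding eventually_at_right_field using r(1)[OF p] by (auto intro!: exI[of _ "r p"])
  qed
  then show ?thesis
    using eventually_at_right_less[of 0]
  proof eventually_elim
    case (elim \<rho>)
    show ?case
    proof
      fix b assume b: "b \<in> B"
      show "inner_part D W \<kappa> \<eta> \<rho> f b = 0"
      proof (cases "f b = 0")
        case False
        then have fb: "b \<in> support_in B f"
          using in_support[OF b] by blast
        have "eta_cut D W \<kappa> \<eta> \<rho> b = 1"
        proof (rule eta_cut_eq_1)
          show "\<rho> \<le> rad W p b" if "p \<in> D" "\<kappa> p b \<noteq> 0" for p
            using elim(1) r(2)[OF that(1) in_support[OF b, of "\<kappa> p"] fb] that by force
        qed (use fb supp elim in auto)
        then show ?thesis
          by (simp add: inner_part_def outer_part_def)
      qed (simp add: inner_part_def outer_part_def)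
    qed
  qed
qed

section \<open>Uniform bounds and the limits of the two terms\<close>

lemma outer_part_bounded:
  assumes "test_function B A f"
  obtains C where "0 \<le> C" "\<And>\<rho> b. 0 < \<rho> \<Longrightarrow> b \<in> B - D \<Longrightarrow> \<bar>outer_part D W \<kappa> \<eta> \<rho> f b\<bar> \<le> C"
proof -
  obtain M where M: "0 \<le> M" "\<And>\<rho> b. 0 < \<rho> \<Longrightarrow> b \<in> B - D \<Longrightarrow> \<bar>eta_cut D W \<kappa> \<eta> \<rho> b\<bar> \<le> M"
    using eta_cut_bounded by metis
  obtain c where c: "0 \<le> c" "\<And>b. b \<in> B \<Longrightarrow> \<bar>f b\<bar> \<le> c"
    using test_function_bounded[OF surf assms] by metis
  show ?thesis
  proof (rule that)
    show "\<bar>outer_part D W \<kappa> \<eta> \<rho> f b\<bar> \<le> M * c" if "0 < \<rho>" "b \<in> B - D" for \<rho> b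
      unfolding outer_part_def abs_mult using M c that by (intro mult_mono) auto
  qed (use M c in simp)
qed

lemma inner_part_bounded:
  assumes "test_function B A f"
  obtains C where "0 \<le> C" "\<And>\<rho> b. 0 < \<rho> \<Longrightarrow> b \<in> B - D \<Longrightarrow> \<bar>inner_part D W \<kappa> \<eta> \<rho> f b\<bar> \<le> C"
proof -
  obtain M where M: "0 \<le> M" "\<And>\<rho> b. 0 < \<rho> \<Longrightarrow> b \<in> B - D \<Longrightarrow> \<bar>outer_part D W \<kappa> \<eta> \<rho> f b\<bar> \<le> M"
    using outer_part_bounded[OF assms] by metis
  obtain c where c: "0 \<le> c" "\<And>b. b \<in> B \<Longrightarrow> \<bar>f b\<bar> \<le> c"
    using test_function_bounded[OF surf assms] by metis
  show ?thesis
  proof (rule that)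
    fix \<rho> b assume \<rho>: "0 < (\<rho>::real)" and b: "b \<in> B - D"
    have "\<bar>f b\<bar> \<le> c"
      using c(2) b by blast
    then show "\<bar>inner_part D W \<kappa> \<eta> \<rho> f b\<bar> \<le> c + M"
      using M(2)[OF \<rho> b] unfolding inner_part_def by linarith
  qed (use M c in simp)
qed

lemma measurable_outer_part:
  assumes "0 < \<rho>" "test_function B A f"
  shows "outer_part D W \<kappa> \<eta> \<rho> f \<in> borel_measurable (restrict_space borel (B - D))"
    "inner_part D W \<kappa> \<eta> \<rho> f \<in> borel_measurable (restrict_space borel (B - D))"
  unfolding inner_part_def outer_part_def
  using measurable_eta_cut[OF assms(1)] measurable_test_function[OF assms(2)] by measurable

lemma cone_integral_tendsto_0:
  assumes p: "p \<in> D" and \<alpha>: "0 < cone_par W p" and t: "0 < t"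
    and Kc: "heat_kernel cone_space cone_atlas (cone_metric (cone_par W p)) (cone_measure (cone_par W p)) (Kc (cone_par W p))"
    and \<Phi>: "test_function B A \<Phi>" and \<Psi>: "test_function B A \<Psi>"
  shows "\<And>\<rho>. 0 < \<rho> \<Longrightarrow> integrable (wedge_measure W p \<Otimes>\<^sub>M wedge_measure W p) (cone_integrand D Kc W \<kappa> \<eta> \<Phi> \<Psi> t \<rho> p)"
    and "((\<lambda>\<rho>. \<integral>z. cone_integrand D Kc W \<kappa> \<eta> \<Phi> \<Psi> t \<rho> p z \<partial>(wedge_measure W p \<Otimes>\<^sub>M wedge_measure W p)) \<longlongrightarrow> 0) (at_right 0)"
proof -
  let ?\<nu> = "wedge_measure W p" and ?k = "\<lambda>b b'. wedge_cone_kernel Kc W p b b' t"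
  note sub = pnbhd_openin(2)[OF wedge p]
  have k: "integrable (?\<nu> \<Otimes>\<^sub>M ?\<nu>) (\<lambda>(b, b'). ?k b b')"
    using wedge_cone_kernel_integrable[where Kc = Kc, OF surf wedge p \<alpha> t Kc] .
  then have [measurable]: "(\<lambda>(b, b'). ?k b b') \<in> borel_measurable (?\<nu> \<Otimes>\<^sub>M ?\<nu>)"
    by (rule borel_measurable_integrable)
  have nonneg: "0 \<le> ?k b b'" if "b \<in> pnbhd W p" "b' \<in> pnbhd W p" for b b'
    using Kc t wedge_map_in(2)[OF wedge p] that by (auto simp: wedge_cone_kernel_def heat_kernel_def)
  have meas: "f \<in> borel_measurable ?\<nu>" if "f \<in> borel_measurable (restrict_space borel (B - D))" for f :: "'a \<Rightarrow> real"
    using measurable_restrict_mono[OF that sub] by (simp add: measurable_cong_sets[OF sets_wedge_measure refl])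
  have [measurable]: "\<kappa> p \<in> borel_measurable ?\<nu>"
    using meas[OF measurable_test_function[OF test_cutoff[OF p]]] .
  obtain c where c: "0 \<le> c" "\<And>b. b \<in> B \<Longrightarrow> \<bar>\<kappa> p b\<bar> \<le> c"
    using test_function_bounded[OF surf test_cutoff[OF p]] by metis
  obtain M where M: "0 \<le> M" "\<And>\<rho> b. 0 < \<rho> \<Longrightarrow> b \<in> B - D \<Longrightarrow> \<bar>inner_part D W \<kappa> \<eta> \<rho> \<Phi> b\<bar> \<le> M"
    using inner_part_bounded[OF \<Phi>] by metis
  obtain N where N: "0 \<le> N" "\<And>\<rho> b. 0 < \<rho> \<Longrightarrow> b \<in> B - D \<Longrightarrow> \<bar>inner_part D W \<kappa> \<eta> \<rho> \<Psi> b\<bar> \<le> N"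
    using inner_part_bounded[OF \<Psi>] by metis
  have F: "cone_integrand D Kc W \<kappa> \<eta> \<Phi> \<Psi> t \<rho> p \<in> borel_measurable (?\<nu> \<Otimes>\<^sub>M ?\<nu>)" if \<rho>: "0 < \<rho>" for \<rho>
  proof -
    note [measurable] = meas[OF measurable_outer_part(2)[OF \<rho> \<Phi>]] meas[OF measurable_outer_part(2)[OF \<rho> \<Psi>]]
    show ?thesis
      unfolding cone_integrand_def by measurable
  qed
  have G: "integrable (?\<nu> \<Otimes>\<^sub>M ?\<nu>) (\<lambda>z. c * c * M * N * (case z of (b, b') \<Rightarrow> ?k b b'))"
    using k by simp
  have bound: "\<bar>cone_integrand D Kc W \<kappa> \<eta> \<Phi> \<Psi> t \<rho> p z\<bar> \<le> c * c * M * N * (case z of (b, b') \<Rightarrow> ?k b b')"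
    if \<rho>: "0 < \<rho>" and z: "z \<in> space (?\<nu> \<Otimes>\<^sub>M ?\<nu>)" for \<rho> z
  proof -
    obtain b b' where b: "z = (b, b')" "b \<in> pnbhd W p" "b' \<in> pnbhd W p"
      using z by (auto simp: space_pair_measure space_wedge_measure)
    then have B: "b \<in> B - D" "b' \<in> B - D"
      using sub by auto
    have "\<bar>\<kappa> p b\<bar> * \<bar>\<kappa> p b'\<bar> * \<bar>inner_part D W \<kappa> \<eta> \<rho> \<Phi> b\<bar> * \<bar>inner_part D W \<kappa> \<eta> \<rho> \<Psi> b'\<bar> \<le> c * c * M * N"
      using c M(1) N(1) M(2)[OF \<rho> B(1)] N(2)[OF \<rho> B(2)] B by (intro mult_mono mult_nonneg_nonneg) auto
    from mult_right_mono[OF this nonneg[OF b(2,3)]] show ?thesis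
      using nonneg[OF b(2,3)] by (simp add: b(1) cone_integrand_def abs_mult ac_simps)
  qed
  have lim: "((\<lambda>\<rho>. cone_integrand D Kc W \<kappa> \<eta> \<Phi> \<Psi> t \<rho> p z) \<longlongrightarrow> 0) (at_right 0)"
    if z: "z \<in> space (?\<nu> \<Otimes>\<^sub>M ?\<nu>)" for z
  proof -
    obtain b b' where b: "z = (b, b')" "b \<in> pnbhd W p" "b' \<in> pnbhd W p"
      using z by (auto simp: space_pair_measure space_wedge_measure)
    then have "b \<in> B - D"
      using sub by auto
    \<comment> \<open>The inner part of \<open>\<Phi>\<close> alone vanishes at the fixed point
      \<open>b\<close> for small \<open>\<rho>\<close>, which already makes the product
      zero.\<close>
    from eventually_eta_cut[OF this]
    have "\<forall>\<^sub>F \<rho> in at_right 0. cone_integrand D Kc W \<kappa> \<eta> \<Phi> \<Psi> t \<rho> p z = 0"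
      by eventually_elim (simp add: b(1) cone_integrand_def inner_part_def outer_part_def)
    then show ?thesis
      by (rule tendsto_eventually)
  qed
  note dom = dominated_convergence_at_right[OF F _ G bound lim]
  show "integrable (?\<nu> \<Otimes>\<^sub>M ?\<nu>) (cone_integrand D Kc W \<kappa> \<eta> \<Phi> \<Psi> t \<rho> p)" if "0 < \<rho>" for \<rho>
    using that by (intro dom(1)) auto
  show "((\<lambda>\<rho>. \<integral>z. cone_integrand D Kc W \<kappa> \<eta> \<Phi> \<Psi> t \<rho> p z \<partial>(?\<nu> \<Otimes>\<^sub>M ?\<nu>)) \<longlongrightarrow> 0) (at_right 0)"
    using dom(3) by simp
qed

lemma bulk_integral_tendsto:
  assumes g: "riemannian_metric (atlas_on A (B - D)) g"
    and \<mu>: "riemannian_measure (B - D) (atlas_on A (B - D)) g \<mu>"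
    and K: "heat_kernel (B - D) (atlas_on A (B - D)) g \<mu> K"
    and conic: "conic_asymptotics D g W \<beta>" and t: "0 < t"
    and \<Phi>: "test_function B A \<Phi>" and \<Psi>: "test_function B A \<Psi>"
  shows "\<And>\<rho>. 0 < \<rho> \<Longrightarrow> integrable (\<mu> \<Otimes>\<^sub>M \<mu>) (bulk_integrand D K W \<kappa> \<eta> \<Phi> \<Psi> t \<rho>)"
    and "integrable (\<mu> \<Otimes>\<^sub>M \<mu>) (\<lambda>(b, b'). K b b' t * \<Phi> b * \<Psi> b')"
    and "((\<lambda>\<rho>. \<integral>z. bulk_integrand D K W \<kappa> \<eta> \<Phi> \<Psi> t \<rho> z \<partial>(\<mu> \<Otimes>\<^sub>M \<mu>)) \<longlongrightarrow>
      (\<integral>(b, b'). K b b' t * \<Phi> b * \<Psi> b' \<partial>(\<mu> \<Otimes>\<^sub>M \<mu>))) (at_right 0)"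
proof -
  have sets: "sets \<mu> = sets (restrict_space borel (B - D))"
    using \<mu> by (simp add: riemannian_measure_def)
  then have space: "space \<mu> = B - D"
    using sets_eq_imp_space_eq[OF sets] by (simp add: space_restrict_space)
  have sf: "sigma_finite_measure \<mu>"
    using riemannian_measure_sigma_finite[OF surf openin_Diff_finite[OF finite_D] g \<mu>] .
  \<comment> \<open>One carrier for both test functions, so that the kernel estimate over a square
    of a single set applies.\<close>
  define S where "S = (support_in B \<Phi> \<union> support_in B \<Psi>) \<inter> (B - D)"
  have "compact (support_in B \<Phi> \<union> support_in B \<Psi>)" "support_in B \<Phi> \<union> support_in B \<Psi> \<subseteq> B"
    using \<Phi> \<Psi> support_in_subset by (auto simp: test_function_def)
  note S = finite_measure_compact[OF surf finite_D g \<mu> wedge conic this, folded S_def]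
  let ?k = "\<lambda>(b, b'). K b b' t * (indicator S b * indicator S b')"
  have k: "integrable (\<mu> \<Otimes>\<^sub>M \<mu>) ?k"
    using heat_kernel_integrable_indicator[OF K sets t sf S] .
  have [measurable]: "(\<lambda>(b, b'). K b b' t) \<in> borel_measurable (\<mu> \<Otimes>\<^sub>M \<mu>)"
    using heat_kernel_measurable[OF K sets t] .
  have nonneg: "0 \<le> K b b' t" if "b \<in> B - D" "b' \<in> B - D" for b b'
    using K t that by (auto simp: heat_kernel_def)
  have meas: "f \<in> borel_measurable \<mu>" if "f \<in> borel_measurable (restrict_space borel (B - D))" for f :: "'a \<Rightarrow> real"
    using that by (simp add: measurable_cong_sets[OF sets refl])
  obtain M where M: "0 \<le> M" "\<And>\<rho> b. 0 < \<rho> \<Longrightarrow> b \<in> B - D \<Longrightarrow> \<bar>outer_part D W \<kappa> \<eta> \<rho> \<Phi> b\<bar> \<le> M"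
    using outer_part_bounded[OF \<Phi>] by metis
  obtain N where N: "0 \<le> N" "\<And>\<rho> b. 0 < \<rho> \<Longrightarrow> b \<in> B - D \<Longrightarrow> \<bar>outer_part D W \<kappa> \<eta> \<rho> \<Psi> b\<bar> \<le> N"
    using outer_part_bounded[OF \<Psi>] by metis
  have F: "bulk_integrand D K W \<kappa> \<eta> \<Phi> \<Psi> t \<rho> \<in> borel_measurable (\<mu> \<Otimes>\<^sub>M \<mu>)" if \<rho>: "0 < \<rho>" for \<rho>
  proof -
    note [measurable] = meas[OF measurable_outer_part(1)[OF \<rho> \<Phi>]] meas[OF measurable_outer_part(1)[OF \<rho> \<Psi>]]
    show ?thesis
      unfolding bulk_integrand_def by measurable
  qed
  have F0: "(\<lambda>(b, b'). K b b' t * \<Phi> b * \<Psi> b') \<in> borel_measurable (\<mu> \<Otimes>\<^sub>M \<mu>)"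
  proof -
    note [measurable] = meas[OF measurable_test_function[OF \<Phi>]] meas[OF measurable_test_function[OF \<Psi>]]
    show ?thesis by measurable
  qed
  have G: "integrable (\<mu> \<Otimes>\<^sub>M \<mu>) (\<lambda>z. M * N * ?k z)"
    using k by simp
  have bound: "\<bar>bulk_integrand D K W \<kappa> \<eta> \<Phi> \<Psi> t \<rho> z\<bar> \<le> M * N * ?k z"
    if \<rho>: "0 < \<rho>" and z: "z \<in> space (\<mu> \<Otimes>\<^sub>M \<mu>)" for \<rho> z
  proof -
    obtain b b' where b: "z = (b, b')" "b \<in> B - D" "b' \<in> B - D"
      using z by (auto simp: space_pair_measure space)
    show ?thesis
    proof (cases "b \<in> S \<and> b' \<in> S")
      case True
      have "\<bar>outer_part D W \<kappa> \<eta> \<rho> \<Phi> b\<bar> * \<bar>outer_part D W \<kappa> \<eta> \<rho> \<Psi> b'\<bar> \<le> M * N"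
        using M(1) N(1) M(2)[OF \<rho> b(2)] N(2)[OF \<rho> b(3)] by (intro mult_mono) auto
      from mult_right_mono[OF this nonneg[OF b(2,3)]] show ?thesis
        using nonneg[OF b(2,3)] True by (simp add: b(1) bulk_integrand_def abs_mult ac_simps)
    next
      \<comment> \<open>Off the square of \<open>S\<close> one of the test functions vanishes, and
        so does the integrand for every \<open>\<rho>\<close>.\<close>
      case False
      then have "\<Phi> b = 0 \<or> \<Psi> b' = 0"
        using in_support[of b B \<Phi>] in_support[of b' B \<Psi>] b by (auto simp: S_def)
      then show ?thesis
        using M(1) N(1) nonneg[OF b(2,3)] by (auto simp: b(1) bulk_integrand_def outer_part_def)
    qed
  qed
  have lim: "((\<lambda>\<rho>. bulk_integrand D K W \<kappa> \<eta> \<Phi> \<Psi> t \<rho> z) \<longlongrightarrow> (case z of (b, b') \<Rightarrow> K b b' t * \<Phi> b * \<Psi> b')) (at_right 0)"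
    if z: "z \<in> space (\<mu> \<Otimes>\<^sub>M \<mu>)" for z
  proof -
    obtain b b' where b: "z = (b, b')" "b \<in> B - D" "b' \<in> B - D"
      using z by (auto simp: space_pair_measure space)
    have "\<forall>\<^sub>F \<rho> in at_right 0. bulk_integrand D K W \<kappa> \<eta> \<Phi> \<Psi> t \<rho> z = (case z of (b, b') \<Rightarrow> K b b' t * \<Phi> b * \<Psi> b')"
      using eventually_eta_cut[OF b(2)] eventually_eta_cut[OF b(3)]
      by eventually_elim (simp add: b(1) bulk_integrand_def outer_part_def)
    then show ?thesis
      by (rule tendsto_eventually)
  qed
  note dom = dominated_convergence_at_right[OF F F0 G bound lim]
  show "integrable (\<mu> \<Otimes>\<^sub>M \<mu>) (bulk_integrand D K W \<kappa> \<eta> \<Phi> \<Psi> t \<rho>)" if "0 < \<rho>" for \<rho>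
    using dom(1)[OF _ _ _ _ that] by blast
  show "integrable (\<mu> \<Otimes>\<^sub>M \<mu>) (\<lambda>(b, b'). K b b' t * \<Phi> b * \<Psi> b')"
    using dom(2) by blast
  show "((\<lambda>\<rho>. \<integral>z. bulk_integrand D K W \<kappa> \<eta> \<Phi> \<Psi> t \<rho> z \<partial>(\<mu> \<Otimes>\<^sub>M \<mu>)) \<longlongrightarrow>
      (\<integral>(b, b'). K b b' t * \<Phi> b * \<Psi> b' \<partial>(\<mu> \<Otimes>\<^sub>M \<mu>))) (at_right 0)"
    using dom(3) by blast
qed

lemma heat_pairing_limit:
  assumes g: "riemannian_metric (atlas_on A (B - D)) g"
    and \<mu>: "riemannian_measure (B - D) (atlas_on A (B - D)) g \<mu>"
    and K: "heat_kernel (B - D) (atlas_on A (B - D)) g \<mu> K"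
    and Kc: "\<forall>\<alpha>>0. heat_kernel cone_space cone_atlas (cone_metric \<alpha>) (cone_measure \<alpha>) (Kc \<alpha>)"
    and conic: "conic_asymptotics D g W \<beta>" and t: "0 < t"
    and \<Phi>: "test_function B A \<Phi>" and \<Psi>: "test_function B A \<Psi>"
  shows "K_ren_exists D \<mu> K Kc W \<kappa> \<eta> \<Phi> \<Psi> t"
    and "K_ren D \<mu> K Kc W \<kappa> \<eta> \<Phi> \<Psi> t = (\<integral>(b, b'). K b b' t * \<Phi> b * \<Psi> b' \<partial>(\<mu> \<Otimes>\<^sub>M \<mu>))"
proof -
  note bulk = bulk_integral_tendsto[OF g \<mu> K conic t \<Phi> \<Psi>]
  have \<alpha>: "0 < cone_par W p" if "p \<in> D" for p
    using conic that by (simp add: conic_asymptotics_def)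
  note cone = cone_integral_tendsto_0[where Kc = Kc, OF _ \<alpha> t _ \<Phi> \<Psi>, OF _ _ Kc[rule_format, OF \<alpha>]]
  have lim: "(heat_pairing D \<mu> K Kc W \<kappa> \<eta> \<Phi> \<Psi> t \<longlongrightarrow> (\<integral>(b, b'). K b b' t * \<Phi> b * \<Psi> b' \<partial>(\<mu> \<Otimes>\<^sub>M \<mu>))) (at_right 0)"
    unfolding heat_pairing_def
    using tendsto_add[OF bulk(3) tendsto_sum[of D, OF cone(2)]] by simp
  have "\<forall>\<^sub>F \<rho> in at_right 0. heat_pairing_defined D \<mu> K Kc W \<kappa> \<eta> \<Phi> \<Psi> t \<rho>"
    using eventually_at_right_less[of 0]
    by eventually_elim (auto simp: heat_pairing_defined_def intro: bulk(1) cone(1))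
  then show "K_ren_exists D \<mu> K Kc W \<kappa> \<eta> \<Phi> \<Psi> t"
    using lim unfolding K_ren_exists_def by blast
  show "K_ren D \<mu> K Kc W \<kappa> \<eta> \<Phi> \<Psi> t = (\<integral>(b, b'). K b b' t * \<Phi> b * \<Psi> b' \<partial>(\<mu> \<Otimes>\<^sub>M \<mu>))"
    \<comment> \<open>The filter \<open>at_right 0\<close> is nontrivial, so \<open>Lim\<close>
      returns exactly this limit.\<close>
    unfolding K_ren_def using lim by (intro tendsto_Lim) auto
qed

end

theorem theorem5p7:
  fixes B D :: "'a::{t2_space, second_countable_topology} set"
    and A :: "'a chart set" and g :: "'a metric" and \<mu> :: "'a measure"
    and K :: "'a \<Rightarrow> 'a \<Rightarrow> real \<Rightarrow> real"
    and Kc :: "real \<Rightarrow> cone_point \<Rightarrow> cone_point \<Rightarrow> real \<Rightarrow> real"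
    and W :: "'a wedge_charts" and \<kappa> \<kappa>t :: "'a \<Rightarrow> 'a \<Rightarrow> real" and \<eta> :: "real \<Rightarrow> real"
    and \<Phi> \<Psi> :: "'a \<Rightarrow> real" and \<beta> \<tau> :: real
  assumes "smooth_surface B A" and "connected B"
    and "finite D" and "D \<subseteq> B"
    and "riemannian_metric (atlas_on A (B - D)) g"
    and "riemannian_measure (B - D) (atlas_on A (B - D)) g \<mu>"
    and "heat_kernel (B - D) (atlas_on A (B - D)) g \<mu> K"
    and "\<forall>\<alpha>>0. heat_kernel cone_space cone_atlas (cone_metric \<alpha>) (cone_measure \<alpha>) (Kc \<alpha>)"
    and "wedge_system B A D W"
    and "conic_asymptotics D g W \<beta>"
    and "cutoffs B A D W \<kappa> \<kappa>t"
    and "conic_parametrix B A D g K Kc W \<beta> \<kappa>"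
    and "cutoff_profile \<eta>"
    and "0 < \<tau>"
    and "test_function B A \<Phi>" and "test_function B A \<Psi>"
  shows "K_ren_exists D \<mu> K Kc W \<kappa> \<eta> \<Phi> \<Psi> \<tau> \<and>
         (\<forall>W' \<beta>' \<kappa>' \<kappa>t' \<eta>'.
           wedge_system B A D W' \<and> conic_asymptotics D g W' \<beta>' \<and>
           cutoffs B A D W' \<kappa>' \<kappa>t' \<and> cutoff_profile \<eta>' \<longrightarrow>
           K_ren_exists D \<mu> K Kc W' \<kappa>' \<eta>' \<Phi> \<Psi> \<tau> \<and>
           K_ren D \<mu> K Kc W' \<kappa>' \<eta>' \<Phi> \<Psi> \<tau> = K_ren D \<mu> K Kc W \<kappa> \<eta> \<Phi> \<Psi> \<tau>) \<and>
         (support_in B \<Phi> \<union> support_in B \<Psi> \<subseteq> B - D \<longrightarrow>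
           (\<forall>\<^sub>F \<rho> in at_right 0. \<forall>b\<in>B. inner_part D W \<kappa> \<eta> \<rho> \<Phi> b = 0 \<and> inner_part D W \<kappa> \<eta> \<rho> \<Psi> b = 0) \<and>
           integrable (\<mu> \<Otimes>\<^sub>M \<mu>) (\<lambda>(b, b'). K b b' \<tau> * \<Phi> b * \<Psi> b') \<and>
           K_ren D \<mu> K Kc W \<kappa> \<eta> \<Phi> \<Psi> \<tau> = (\<integral>(b, b'). K b b' \<tau> * \<Phi> b * \<Psi> b' \<partial>(\<mu> \<Otimes>\<^sub>M \<mu>)))"
proof -
  interpret conic_cutoffs B D A W \<kappa> \<kappa>t \<eta>
    using assms by unfold_locales
  have lim': "K_ren_exists D \<mu> K Kc W' \<kappa>' \<eta>' \<Phi> \<Psi> \<tau>"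
    "K_ren D \<mu> K Kc W' \<kappa>' \<eta>' \<Phi> \<Psi> \<tau> = (\<integral>(b, b'). K b b' \<tau> * \<Phi> b * \<Psi> b' \<partial>(\<mu> \<Otimes>\<^sub>M \<mu>))"
    if "wedge_system B A D W'" "conic_asymptotics D g W' \<beta>'" "cutoffs B A D W' \<kappa>' \<kappa>t'" "cutoff_profile \<eta>'"
    for W' \<beta>' \<kappa>' \<kappa>t' \<eta>'
  proof -
    \<comment> \<open>The competing choice. Its cone parameters may differ from those of
      \<open>W\<close>; since \<open>Kc\<close> is a family of heat kernels for all positive
      parameters, the limit theorem applies to it as well.\<close>
    interpret other: conic_cutoffs B D A W' \<kappa>' \<kappa>t' \<eta>'
      using assms(1,3) that by unfold_locales
    show "K_ren_exists D \<mu> K Kc W' \<kappa>' \<eta>' \<Phi> \<Psi> \<tau>"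
      "K_ren D \<mu> K Kc W' \<kappa>' \<eta>' \<Phi> \<Psi> \<tau> = (\<integral>(b, b'). K b b' \<tau> * \<Phi> b * \<Psi> b' \<partial>(\<mu> \<Otimes>\<^sub>M \<mu>))"
      using other.heat_pairing_limit[OF assms(5-8) that(2) assms(14-16)] by simp_all
  qed
  note lim = heat_pairing_limit[OF assms(5-8,10,14-16)]
  have "\<forall>\<^sub>F \<rho> in at_right 0. \<forall>b\<in>B. inner_part D W \<kappa> \<eta> \<rho> \<Phi> b = 0 \<and> inner_part D W \<kappa> \<eta> \<rho> \<Psi> b = 0"
    if supp: "support_in B \<Phi> \<union> support_in B \<Psi> \<subseteq> B - D"
  proof -
    have "\<forall>\<^sub>F \<rho> in at_right 0. \<forall>b\<in>B. inner_part D W \<kappa> \<eta> \<rho> \<Phi> b = 0"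
      "\<forall>\<^sub>F \<rho> in at_right 0. \<forall>b\<in>B. inner_part D W \<kappa> \<eta> \<rho> \<Psi> b = 0"
      using supp assms(15,16) by (auto intro!: eventually_inner_part_eq_0)
    then show ?thesis
      by eventually_elim blast
  qed
  moreover have "integrable (\<mu> \<Otimes>\<^sub>M \<mu>) (\<lambda>(b, b'). K b b' \<tau> * \<Phi> b * \<Psi> b')"
    using bulk_integral_tendsto(2)[OF assms(5-7,10,14-16)] .
  moreover have "K_ren_exists D \<mu> K Kc W' \<kappa>' \<eta>' \<Phi> \<Psi> \<tau> \<and>
      K_ren D \<mu> K Kc W' \<kappa>' \<eta>' \<Phi> \<Psi> \<tau> = K_ren D \<mu> K Kc W \<kappa> \<eta> \<Phi> \<Psi> \<tau>"
    if "wedge_system B A D W' \<and> conic_asymptotics D g W' \<beta>' \<and> cutoffs B A D W' \<kappa>' \<kappa>t' \<and> cutoff_profile \<eta>'"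
    for W' \<beta>' \<kappa>' \<kappa>t' \<eta>'
    using that lim'[of W' \<beta>' \<kappa>' \<kappa>t' \<eta>'] lim(2) by simp
  ultimately show ?thesis
    using lim by blast
qed

end
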